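(* Let $\Omega_1,\dots,\Omega_n$ be finite sets and let $\mu$ be an unknown distribution over $\prod_{i=1}^n\Omega_i$, accessible through the subcube oracle. For every $0<\varepsilon<1$ there is an algorithm using $\tilde O\big(\sum_{i=1}^n\log|\Omega_i|/\varepsilon^2\big)$ subcube queries that, with probability at least $2/3$, accepts if $\mu$ is a product distribution, and with probability at least $2/3$ rejects if $\mu$ is $\varepsilon$-far (in total variation distance) from every product distribution. Moreover, if $|\Omega_i|=2$ for every $1\le i\le n$, then all queries made are prefix queries.
   Context: A distribution $\mu$ over $\prod_{i=1}^n\Omega_i$ is a product distribution if $\mu=\mu_1\times\cdots\times\mu_n$ for some distributions $\mu_i$ over $\Omega_i$. The subcube oracle takes as input a tuple $(A_1,\dots,A_n)$ with $A_i\subseteq\Omega_i$ and returns an independent sample of $\mu$ conditioned on $\prod_{i=1}^nA_i$ (error if this has probability $0$). A prefix query is a subcube query in which, for some index $i$, $A_j$ is a singleton for all $j<i$, $A_i\subseteq\Omega_i$ is arbitrary, and $A_j=\Omega_j$ for all $j>i$ (in the binary case $\Omega_i=\{0,1\}$, this amounts to conditioning on $x_{[k]}=w$ for some $0\le k\le n-1$, $w\in\{0,1\}^k$). $\varepsilon$-far means total variation distance greater than $\varepsilon$. $\tilde O$ hides polylogarithmic factors. *)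

theory Defs
  imports "HOL-Probability.Probability"
begin

definition tv_dist :: "'x pmf \<Rightarrow> 'x pmf \<Rightarrow> real" where
  "tv_dist p q = (SUP S. \<bar>measure_pmf.prob p S - measure_pmf.prob q S\<bar>)"

text \<open>
  Points of the product of \<open>\<Omega> 1, \<dots>, \<Omega> n\<close> are the elements of \<open>PiE {1..n} \<Omega>\<close>, i.e.\ functions
  with the value \<open>undefined\<close> outside \<open>{1..n}\<close>; this is the default value given to \<^const>\<open>Pi_pmf\<close>.
\<close>

definition distribution_over :: "nat \<Rightarrow> (nat \<Rightarrow> 'a set) \<Rightarrow> (nat \<Rightarrow> 'a) pmf \<Rightarrow> bool" where
  "distribution_over n \<Omega> \<mu> \<longleftrightarrow> set_pmf \<mu> \<subseteq> PiE {1..n} \<Omega>"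

definition product_distribution :: "nat \<Rightarrow> (nat \<Rightarrow> 'a set) \<Rightarrow> (nat \<Rightarrow> 'a) pmf \<Rightarrow> bool" where
  "product_distribution n \<Omega> \<mu> \<longleftrightarrow>
     (\<exists>m. (\<forall>i\<in>{1..n}. set_pmf (m i) \<subseteq> \<Omega> i) \<and> \<mu> = Pi_pmf {1..n} undefined m)"

definition far_from_product :: "nat \<Rightarrow> (nat \<Rightarrow> 'a set) \<Rightarrow> real \<Rightarrow> (nat \<Rightarrow> 'a) pmf \<Rightarrow> bool" where
  "far_from_product n \<Omega> \<epsilon> \<mu> \<longleftrightarrow> (\<forall>\<nu>. product_distribution n \<Omega> \<nu> \<longrightarrow> tv_dist \<mu> \<nu> > \<epsilon>)"

definition subcube_query :: "nat \<Rightarrow> (nat \<Rightarrow> 'a set) \<Rightarrow> (nat \<Rightarrow> 'a set) \<Rightarrow> bool" where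
  "subcube_query n \<Omega> A \<longleftrightarrow> (\<forall>i\<in>{1..n}. A i \<subseteq> \<Omega> i)"

definition prefix_query :: "nat \<Rightarrow> (nat \<Rightarrow> 'a set) \<Rightarrow> (nat \<Rightarrow> 'a set) \<Rightarrow> bool" where
  "prefix_query n \<Omega> A \<longleftrightarrow> subcube_query n \<Omega> A \<and>
     (\<exists>i\<in>{1..n}. (\<forall>j\<in>{1..<i}. is_singleton (A j)) \<and> (\<forall>j\<in>{i<..n}. A j = \<Omega> j))"

text \<open>The answer \<^const>\<open>None\<close> is the error answer to a query of probability zero.\<close>

definition subcube_oracle ::
  "nat \<Rightarrow> (nat \<Rightarrow> 'a) pmf \<Rightarrow> (nat \<Rightarrow> 'a set) \<Rightarrow> (nat \<Rightarrow> 'a) option pmf" where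
  "subcube_oracle n \<mu> A =
     (if measure_pmf.prob \<mu> (PiE {1..n} A) = 0 then return_pmf None
      else map_pmf Some (cond_pmf \<mu> (PiE {1..n} A)))"

text \<open>
  Adaptive randomized decision procedures with oracle access: \<open>Output True\<close> accepts,
  \<open>Output False\<close> rejects, \<open>Coin\<close> makes an internal random choice, and \<open>Query A c\<close> continues with
  \<open>c r\<close> on the oracle's answer \<open>r\<close> to \<open>A\<close>.
\<close>

datatype (dead 'q, dead 'r) oracle_alg =
    Output bool
  | Coin "('q, 'r) oracle_alg pmf"
  | Query 'q "'r \<Rightarrow> ('q, 'r) oracle_alg"

type_synonym 'a subcube_alg = "(nat \<Rightarrow> 'a set, (nat \<Rightarrow> 'a) option) oracle_alg"

primrec run :: "('q \<Rightarrow> 'r pmf) \<Rightarrow> ('q, 'r) oracle_alg \<Rightarrow> bool pmf" where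
  "run orc (Output b) = return_pmf b"
| "run orc (Coin p) = join_pmf (map_pmf (run orc) p)"
| "run orc (Query a c) = bind_pmf (orc a) (\<lambda>r. run orc (c r))"

text \<open>
  The two predicates below are worst-case: they range over every internal random choice of positive
  probability and every conceivable answer of the oracle.
\<close>

inductive queries_at_most :: "nat \<Rightarrow> ('q, 'r) oracle_alg \<Rightarrow> bool" where
  "queries_at_most q (Output b)"
| "(\<forall>t\<in>set_pmf p. queries_at_most q t) \<Longrightarrow> queries_at_most q (Coin p)"
| "(\<forall>r. queries_at_most q (c r)) \<Longrightarrow> queries_at_most (Suc q) (Query a c)"

inductive all_queries :: "('q \<Rightarrow> bool) \<Rightarrow> ('q, 'r) oracle_alg \<Rightarrow> bool" for P where
  "all_queries P (Output b)"
| "(\<forall>t\<in>set_pmf p. all_queries P t) \<Longrightarrow> all_queries P (Coin p)"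
| "P a \<Longrightarrow> (\<forall>r. all_queries P (c r)) \<Longrightarrow> all_queries P (Query a c)"

end

theory Submission imports Defs begin

text \<open>
  Encode each \<open>\<Omega> i\<close> by \<open>\<lceil>log 2 |\<Omega> i|\<rceil>\<close> bits and compare \<open>\<mu>\<close> with the product \<open>\<nu>\<close> of its marginals one bit
  at a time: for \<open>x\<close> drawn from \<open>\<mu>\<close> and a bit \<open>t\<close> of coordinate \<open>i\<close>, let \<open>p\<close> and \<open>q\<close> be the probabilities of
  that bit under \<open>\<mu>\<close> and \<open>\<nu>\<close> given all earlier bits of \<open>x\<close>. Both biased coins can be sampled by subcube
  queries, since under \<open>\<nu>\<close> only the earlier bits of the same coordinate matter.

  If \<open>\<mu>\<close> is a product then \<open>p = q\<close> always. If it is \<open>\<epsilon>\<close>-far, a chain inequality for the squared Hellinger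
  distance, with the expectation taken under \<open>\<mu>\<close> only, shows that the sum over all bits of the
  expectation of \<open>(p - q)\<^sup>2 / (p + q - 2pq)\<close> is at least of order \<open>\<epsilon>\<^sup>2\<close>. Two coins with this gap \<open>\<delta>\<close> are
  told apart by about \<open>1 / \<delta>\<close> pairs of tosses, so a search over dyadic scales of \<open>\<delta>\<close>, spending the same
  total effort on each scale, detects the discrepancy within the claimed number of queries.
\<close>

section \<open>Hellinger distance along a refining sequence of partitions\<close>

text \<open>
  The squared distance \<open>y\<close> itself need not telescope over refinement steps. The convex potential
  \<open>y + y\<^sup>2\<close> does telescope: its average gains the variance of the children's distances, which pays for the
  cross term.
\<close>

lemma hellinger_refine_real:
  fixes a0 a1 b0 b1 y0 y1 :: real
  assumes nonneg: "0 \<le> a0" "0 \<le> a1" "0 \<le> b0" "0 \<le> b1"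
    and a: "a0\<^sup>2 + a1\<^sup>2 = 1" and b: "b0\<^sup>2 + b1\<^sup>2 = 1"
    and y0: "0 \<le> y0" "y0 \<le> 1" and y1: "0 \<le> y1" "y1 \<le> 1"
    and y: "y = 1 - a0 * b0 * (1 - y0) - a1 * b1 * (1 - y1)"
  shows "y + y\<^sup>2 \<le> 15/2 * (1 - (a0 * b0 + a1 * b1)) + a0\<^sup>2 * (y0 + y0\<^sup>2) + a1\<^sup>2 * (y1 + y1\<^sup>2)"
proof -
  \<comment> \<open>\<open>h\<close> is the squared Hellinger distance of the split itself,
    \<open>m\<close> the mean of the children's distances under the first measure,
    \<open>u\<^sup>2\<close> their variance. As \<open>(a0, a1)\<close> and \<open>(b0, b1)\<close>
    are unit vectors, \<open>1 - h\<close> is the cosine of their angle and \<open>v\<close> its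
    sine up to sign.\<close>
  define h where "h = 1 - (a0 * b0 + a1 * b1)"
  define m where "m = a0\<^sup>2 * y0 + a1\<^sup>2 * y1"
  define u where "u = a0 * a1 * (y0 - y1)"
  define v where "v = b0 * a1 - b1 * a0"
  define e where "e = 5/2 * h + u\<^sup>2 / 3"
  have v2: "v\<^sup>2 = 1 - (1 - h)\<^sup>2"
  proof -
    have "v\<^sup>2 + (1 - h)\<^sup>2 = (a0\<^sup>2 + a1\<^sup>2) * (b0\<^sup>2 + b1\<^sup>2)"
      unfolding v_def h_def by (simp add: power2_eq_square algebra_simps)
    then show ?thesis using a b by simp
  qed
  have h0: "0 \<le> h"
  proof -
    have "2 * h = (a0 - b0)\<^sup>2 + (a1 - b1)\<^sup>2"
      using a b unfolding h_def by (simp add: power2_eq_square algebra_simps)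
    then show ?thesis by (smt (verit) zero_le_power2)
  qed
  have m0: "0 \<le> m" "m \<le> 1"
  proof -
    show "0 \<le> m" unfolding m_def using y0 y1 by simp
    have "m \<le> a0\<^sup>2 * 1 + a1\<^sup>2 * 1"
      unfolding m_def using y0 y1 by (intro add_mono mult_left_mono) auto
    then show "m \<le> 1" using a by simp
  qed
  have y01: "0 \<le> y" "y \<le> 1"
  proof -
    have "a0 * b0 * (1 - y0) \<le> a0 * b0" "a1 * b1 * (1 - y1) \<le> a1 * b1"
      using nonneg y0 y1 by (auto intro!: mult_right_le_one_le)
    then show "0 \<le> y" using h0 unfolding y h_def by linarith
    have "0 \<le> a0 * b0 * (1 - y0)" "0 \<le> a1 * b1 * (1 - y1)" using nonneg y0 y1 by simp_all
    then show "y \<le> 1" unfolding y by linarith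
  qed
  have ym: "y - m = h - h * m + u * v"
  proof -
    have "y - m = h + a0 * b0 * y0 + a1 * b1 * y1 - m" unfolding y h_def by (simp add: algebra_simps)
    moreover have "u * v + (1 - h) * m = a0 * b0 * y0 + a1 * b1 * y1"
    proof -
      have "u * v + (1 - h) * m = (a0\<^sup>2 + a1\<^sup>2) * (a0 * b0 * y0 + a1 * b1 * y1)"
        unfolding u_def v_def h_def m_def by (simp add: power2_eq_square algebra_simps)
      then show ?thesis using a by simp
    qed
    ultimately show ?thesis by (simp add: algebra_simps)
  qed
  \<comment> \<open>The weight 1/3 is dictated by what follows: since \<open>y + m \<le> 2\<close>,
    an excess \<open>e\<close> of \<open>y\<close> over \<open>m\<close> raises the potential by at
    most \<open>3 * e\<close>, and only one full variance \<open>u\<^sup>2\<close> is available to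
    pay for it.\<close>
  have "u * v \<le> u\<^sup>2 / 3 + 3/4 * v\<^sup>2"
  proof -
    have "0 \<le> (2 * u - 3 * v)\<^sup>2" by simp
    then show ?thesis by (simp add: power2_eq_square algebra_simps)
  qed
  also have "\<dots> \<le> u\<^sup>2 / 3 + 3/4 * (2 * h)"
    unfolding v2 by (simp add: power2_eq_square algebra_simps)
  finally have "y - m \<le> e"
    using ym h0 m0 mult_nonneg_nonneg[OF h0 m0(1)] unfolding e_def by linarith
  moreover have e0: "0 \<le> e" unfolding e_def using h0 by simp
  ultimately have "y\<^sup>2 - m\<^sup>2 \<le> 2 * e"
  proof -
    have "y\<^sup>2 - m\<^sup>2 = (y - m) * (y + m)" by (simp add: power2_eq_square algebra_simps)
    also have "\<dots> \<le> e * (y + m)" using \<open>y - m \<le> e\<close> y01 m0 by (intro mult_right_mono) auto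
    also have "\<dots> \<le> e * 2" using e0 y01 m0 by (intro mult_left_mono) auto
    finally show ?thesis by simp
  qed
  moreover have e3: "3 * e = 15/2 * h + u\<^sup>2" unfolding e_def by simp
  ultimately have "y + y\<^sup>2 \<le> m + m\<^sup>2 + 15/2 * h + u\<^sup>2"
    using \<open>y - m \<le> e\<close> e3 by linarith
  \<comment> \<open>The mean square is the squared mean plus the variance, so
    \<open>u\<^sup>2\<close> is absorbed exactly.\<close>
  also have "m + m\<^sup>2 + u\<^sup>2 = a0\<^sup>2 * (y0 + y0\<^sup>2) + a1\<^sup>2 * (y1 + y1\<^sup>2)"
  proof -
    have "m\<^sup>2 + u\<^sup>2 = (a0\<^sup>2 + a1\<^sup>2) * (a0\<^sup>2 * y0\<^sup>2 + a1\<^sup>2 * y1\<^sup>2)"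
      unfolding m_def u_def by (simp add: power2_eq_square algebra_simps)
    then show ?thesis using a unfolding m_def by (simp add: algebra_simps)
  qed
  then have "m + m\<^sup>2 + 15/2 * h + u\<^sup>2 = 15/2 * h + a0\<^sup>2 * (y0 + y0\<^sup>2) + a1\<^sup>2 * (y1 + y1\<^sup>2)"
    by linarith
  finally show ?thesis unfolding h_def .
qed

text \<open>
  For independent coins \<open>a\<close>, \<open>b\<close> of biases \<open>p\<close>, \<open>q\<close> the denominator is the probability of \<open>a \<noteq> b\<close>. It vanishes
  only for \<open>p = q\<close>, where division by zero gives the intended value 0.
\<close>

definition sign_gap :: "real \<Rightarrow> real \<Rightarrow> real" where
  "sign_gap p q = (p - q)\<^sup>2 / (p + q - 2 * p * q)"

text \<open>The quantity is the sum of \<open>p * (1 - q)\<close> and \<open>q * (1 - p)\<close>,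
  whose difference is \<open>p - q\<close>; this gives the first bound, and the second follows from
  \<open>\<bar>p - q\<bar> \<le> 1\<close>.\<close>

lemma discordance_bounds:
  fixes p q :: real
  assumes "0 \<le> p" "p \<le> 1" "0 \<le> q" "q \<le> 1"
  shows "\<bar>p - q\<bar> \<le> p + q - 2 * p * q" "(p - q)\<^sup>2 \<le> p + q - 2 * p * q" "p + q - 2 * p * q \<le> 1"
proof -
  have *: "0 \<le> p * (1 - q)" "0 \<le> q * (1 - p)" "0 \<le> (1 - p) * (1 - q)" "0 \<le> p * q"
    using assms by simp_all
  show 1: "\<bar>p - q\<bar> \<le> p + q - 2 * p * q"
    using * by (simp add: algebra_simps abs_le_iff)
  have "\<bar>p - q\<bar> \<le> 1" using assms by (simp add: abs_le_iff)
  then have "\<bar>p - q\<bar> * \<bar>p - q\<bar> \<le> \<bar>p - q\<bar> * 1" by (intro mult_left_mono) auto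
  then have "(p - q)\<^sup>2 \<le> \<bar>p - q\<bar>" by (simp add: power2_eq_square)
  with 1 show "(p - q)\<^sup>2 \<le> p + q - 2 * p * q" by linarith
  show "p + q - 2 * p * q \<le> 1" using * by (simp add: algebra_simps)
qed

lemma sign_gap_bounds:
  assumes "0 \<le> p" "p \<le> 1" "0 \<le> q" "q \<le> 1"
  shows "0 \<le> sign_gap p q" "sign_gap p q \<le> 1"
  using discordance_bounds[OF assms] unfolding sign_gap_def
  by (auto simp: divide_le_eq_1 intro!: divide_nonneg_nonneg)

text \<open>Let \<open>c\<close> and \<open>d\<close> be the cosine and signed sine of the angle
  between the vectors of square roots. Then \<open>1 - c \<le> 1 - c\<^sup>2 = d\<^sup>2\<close>.
  Moreover \<open>p - q\<close> is \<open>d\<close> times a factor whose square is at least the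
  denominator of \<open>sign_gap p q\<close>, so \<open>d\<^sup>2\<close> is at most the
  gap.\<close>

lemma hellinger_le_sign_gap:
  assumes "0 \<le> p" "p \<le> 1" "0 \<le> q" "q \<le> 1"
  shows "1 - (sqrt (p * q) + sqrt ((1 - p) * (1 - q))) \<le> sign_gap p q"
proof -
  define a0 a1 b0 b1 where "a0 = sqrt p" and "a1 = sqrt (1 - p)" and "b0 = sqrt q" and "b1 = sqrt (1 - q)"
  note ab_def = a0_def a1_def b0_def b1_def
  have sq: "a0\<^sup>2 = p" "a1\<^sup>2 = 1 - p" "b0\<^sup>2 = q" "b1\<^sup>2 = 1 - q"
    unfolding ab_def using assms by simp_all
  have nn: "0 \<le> a0" "0 \<le> a1" "0 \<le> b0" "0 \<le> b1" unfolding ab_def using assms by simp_all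
  define c where "c = a0 * b0 + a1 * b1"
  define d where "d = a0 * b1 - a1 * b0"
  define s where "s = p + q - 2 * p * q"
  have c0: "0 \<le> c" unfolding c_def using nn by simp
  have cd: "c\<^sup>2 + d\<^sup>2 = 1"
  proof -
    have "c\<^sup>2 + d\<^sup>2 = (a0\<^sup>2 + a1\<^sup>2) * (b0\<^sup>2 + b1\<^sup>2)"
      unfolding c_def d_def by (simp add: power2_eq_square algebra_simps)
    then show ?thesis using sq by simp
  qed
  have c1: "c \<le> 1" using cd by (smt (verit) one_less_power zero_le_power2 pos2)
  have "c * c \<le> c * 1" using c0 c1 by (intro mult_left_mono) auto
  then have "1 - c \<le> d\<^sup>2" using cd by (simp add: power2_eq_square)
  also have "d\<^sup>2 \<le> sign_gap p q"
  proof -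
    have s: "s = a0\<^sup>2 * b1\<^sup>2 + a1\<^sup>2 * b0\<^sup>2" unfolding s_def sq by (simp add: algebra_simps)
    have pq: "p - q = d * (a0 * b1 + a1 * b0)"
    proof -
      have "d * (a0 * b1 + a1 * b0) = a0\<^sup>2 * b1\<^sup>2 - a1\<^sup>2 * b0\<^sup>2"
        unfolding d_def by (simp add: power2_eq_square algebra_simps)
      then show ?thesis unfolding sq by (simp add: algebra_simps)
    qed
    have le: "s \<le> (a0 * b1 + a1 * b0)\<^sup>2"
      using nn unfolding s by (simp add: power2_eq_square algebra_simps)
    show ?thesis
    proof (cases "s = 0")
      case True
      then have "p - q = 0" using discordance_bounds(1)[OF assms] unfolding s_def by simp
      moreover from True have "(a0 * b1)\<^sup>2 + (a1 * b0)\<^sup>2 = 0" unfolding s by (simp add: power_mult_distrib)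
      then have "a0 * b1 = 0" "a1 * b0 = 0" by (simp_all only: sum_power2_eq_zero_iff)
      then have "d = 0" unfolding d_def by linarith
      ultimately show ?thesis by (simp add: sign_gap_def)
    next
      case False
      then have "0 < s" unfolding s by (simp add: less_le)
      moreover have "d\<^sup>2 * s \<le> d\<^sup>2 * (a0 * b1 + a1 * b0)\<^sup>2" using le by (intro mult_left_mono) auto
      ultimately show ?thesis
        unfolding sign_gap_def s_def[symmetric] pq by (simp add: pos_le_divide_eq power_mult_distrib)
    qed
  qed
  finally show ?thesis unfolding c_def ab_def by (simp add: real_sqrt_mult)
qed

section \<open>Hellinger distance of weights conditioned on a set\<close>

definition affinity :: "('x \<Rightarrow> real) \<Rightarrow> ('x \<Rightarrow> real) \<Rightarrow> 'x set \<Rightarrow> real" where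
  "affinity P Q A = (\<Sum>x\<in>A. sqrt (P x * Q x))"

text \<open>Squared Hellinger distance of the conditional distributions on \<open>A\<close>. If one
  of them has mass 0, division by zero makes it 1, which stays in the unit interval and keeps the
  product formula for the affinity valid.\<close>

definition hellinger_on :: "('x \<Rightarrow> real) \<Rightarrow> ('x \<Rightarrow> real) \<Rightarrow> 'x set \<Rightarrow> real" where
  "hellinger_on P Q A = 1 - affinity P Q A / sqrt (sum P A * sum Q A)"

lemma affinity_bounds:
  assumes "\<And>x. x \<in> A \<Longrightarrow> 0 \<le> P x" "\<And>x. x \<in> A \<Longrightarrow> 0 \<le> Q x"
  shows "0 \<le> affinity P Q A" "affinity P Q A \<le> sqrt (sum P A * sum Q A)"
proof -
  show "0 \<le> affinity P Q A" unfolding affinity_def using assms by (intro sum_nonneg) simp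
  have "affinity P Q A = (\<Sum>x\<in>A. \<bar>sqrt (P x)\<bar> * \<bar>sqrt (Q x)\<bar>)"
    unfolding affinity_def using assms by (intro sum.cong) (auto simp: real_sqrt_mult)
  also have "\<dots> \<le> L2_set (\<lambda>x. sqrt (P x)) A * L2_set (\<lambda>x. sqrt (Q x)) A"
    by (rule L2_set_mult_ineq)
  also have "\<dots> = sqrt (sum P A * sum Q A)"
    unfolding L2_set_def real_sqrt_mult using assms
    by (intro arg_cong2[where f="(*)"] arg_cong[where f=sqrt] sum.cong) auto
  finally show "affinity P Q A \<le> sqrt (sum P A * sum Q A)" .
qed

lemma hellinger_on_bounds:
  assumes "\<And>x. x \<in> A \<Longrightarrow> 0 \<le> P x" "\<And>x. x \<in> A \<Longrightarrow> 0 \<le> Q x"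
  shows "0 \<le> hellinger_on P Q A" "hellinger_on P Q A \<le> 1"
    "affinity P Q A = sqrt (sum P A * sum Q A) * (1 - hellinger_on P Q A)"
proof -
  have nn: "0 \<le> sqrt (sum P A * sum Q A)" using assms by (simp add: sum_nonneg)
  note b = affinity_bounds[of A P Q, OF assms]
  show "0 \<le> hellinger_on P Q A" "hellinger_on P Q A \<le> 1"
    unfolding hellinger_on_def using divide_right_mono[OF b(2) nn] divide_nonneg_nonneg[OF b(1) nn]
    by (auto split: if_splits simp: divide_self_if simp del: real_sqrt_mult)
  show "affinity P Q A = sqrt (sum P A * sum Q A) * (1 - hellinger_on P Q A)"
    unfolding hellinger_on_def using b nn
    by (cases "sqrt (sum P A * sum Q A) = 0") (auto simp del: real_sqrt_eq_0_iff mult_eq_0_iff)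
qed

text \<open>The affinity is additive over the two halves of \<open>A\<close>. Normalised, the halves
  get the weights \<open>sqrt p * sqrt q\<close> and \<open>sqrt (1 - p) * sqrt (1 - q)\<close>,
  which is the situation of \<open>hellinger_refine_real\<close>.\<close>

lemma hellinger_split:
  assumes fin: "finite A" and PQ: "\<And>x. x \<in> A \<Longrightarrow> 0 \<le> P x" "\<And>x. x \<in> A \<Longrightarrow> 0 \<le> Q x"
    and pos: "0 < sum P A" "0 < sum Q A"
  shows "hellinger_on P Q A + (hellinger_on P Q A)\<^sup>2
    \<le> 15/2 * sign_gap (sum P (A \<inter> B) / sum P A) (sum Q (A \<inter> B) / sum Q A)
      + sum P (A \<inter> B) / sum P A * (hellinger_on P Q (A \<inter> B) + (hellinger_on P Q (A \<inter> B))\<^sup>2)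
      + sum P (A - B) / sum P A * (hellinger_on P Q (A - B) + (hellinger_on P Q (A - B))\<^sup>2)"
proof -
  define p where "p = sum P (A \<inter> B) / sum P A"
  define q where "q = sum Q (A \<inter> B) / sum Q A"
  have split: "sum f A = sum f (A \<inter> B) + sum f (A - B)" for f :: "_ \<Rightarrow> real"
    using fin by (simp add: sum.Int_Diff)
  have p': "sum P (A - B) / sum P A = 1 - p"
    unfolding p_def using pos split[of P] by (simp add: field_simps)
  have q': "sum Q (A - B) / sum Q A = 1 - q"
    unfolding q_def using pos split[of Q] by (simp add: field_simps)
  have nnP: "0 \<le> sum P (A \<inter> B)" "0 \<le> sum P (A - B)" "0 \<le> sum Q (A \<inter> B)" "0 \<le> sum Q (A - B)"
    using PQ by (auto intro!: sum_nonneg)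
  have p: "0 \<le> p" "p \<le> 1"
    using nnP pos split[of P] unfolding p_def by (auto simp: divide_le_eq_1)
  have q: "0 \<le> q" "q \<le> 1"
    using nnP pos split[of Q] unfolding q_def by (auto simp: divide_le_eq_1)
  let ?y = "hellinger_on P Q"
  have bnd: "0 \<le> ?y S" "?y S \<le> 1" "affinity P Q S = sqrt (sum P S * sum Q S) * (1 - ?y S)" if "S \<subseteq> A" for S
    using hellinger_on_bounds[of S P Q] PQ that by blast+
  have "?y A = 1 - (affinity P Q (A \<inter> B) + affinity P Q (A - B)) / sqrt (sum P A * sum Q A)"
    unfolding hellinger_on_def affinity_def split[of "\<lambda>x. sqrt (P x * Q x)"] ..
  also have "\<dots> = 1 - sqrt (sum P (A \<inter> B) * sum Q (A \<inter> B)) / sqrt (sum P A * sum Q A) * (1 - ?y (A \<inter> B))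
      - sqrt (sum P (A - B) * sum Q (A - B)) / sqrt (sum P A * sum Q A) * (1 - ?y (A - B))"
    by (subst (1 2) bnd(3)) (auto simp: add_divide_distrib)
  also have "sqrt (sum P (A \<inter> B) * sum Q (A \<inter> B)) / sqrt (sum P A * sum Q A) = sqrt p * sqrt q"
    unfolding p_def q_def by (simp add: real_sqrt_mult real_sqrt_divide)
  also have "sqrt (sum P (A - B) * sum Q (A - B)) / sqrt (sum P A * sum Q A) = sqrt (1 - p) * sqrt (1 - q)"
    unfolding p'[symmetric] q'[symmetric] by (simp add: real_sqrt_mult real_sqrt_divide)
  finally have y: "?y A = 1 - sqrt p * sqrt q * (1 - ?y (A \<inter> B)) - sqrt (1 - p) * sqrt (1 - q) * (1 - ?y (A - B))" .
  have "?y A + (?y A)\<^sup>2 \<le> 15/2 * (1 - (sqrt p * sqrt q + sqrt (1 - p) * sqrt (1 - q)))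
      + (sqrt p)\<^sup>2 * (?y (A \<inter> B) + (?y (A \<inter> B))\<^sup>2) + (sqrt (1 - p))\<^sup>2 * (?y (A - B) + (?y (A - B))\<^sup>2)"
    by (rule hellinger_refine_real[OF _ _ _ _ _ _ _ _ _ _ y]) (use p q bnd in auto)
  moreover have "1 - (sqrt p * sqrt q + sqrt (1 - p) * sqrt (1 - q)) \<le> sign_gap p q"
    using hellinger_le_sign_gap[OF p q] by (simp add: real_sqrt_mult)
  then have "15/2 * (1 - (sqrt p * sqrt q + sqrt (1 - p) * sqrt (1 - q))) \<le> 15/2 * sign_gap p q"
    by (intro mult_left_mono) auto
  moreover have p1: "0 \<le> 1 - p" using p by simp
  ultimately show ?thesis
    unfolding p' p_def[symmetric] q_def[symmetric] real_sqrt_pow2[OF p(1)]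
      real_sqrt_pow2[OF p1] by linarith
qed

text \<open>\<open>R x\<close> is the class of \<open>x\<close> in a partition of \<open>X\<close>,
  and \<open>B\<close> splits every class in two. The split inequality is averaged over classes with
  the weights of \<open>P\<close> alone; classes of positive \<open>P\<close>-mass have positive
  \<open>Q\<close>-mass by absolute continuity.\<close>

lemma hellinger_refine:
  assumes fin: "finite X"
    and P: "\<And>x. x \<in> X \<Longrightarrow> 0 \<le> P x" and Q: "\<And>x. x \<in> X \<Longrightarrow> 0 \<le> Q x"
    and ac: "\<And>x. x \<in> X \<Longrightarrow> 0 < P x \<Longrightarrow> 0 < Q x"
    and R: "\<And>x. x \<in> X \<Longrightarrow> R x \<subseteq> X" "\<And>x. x \<in> X \<Longrightarrow> x \<in> R x"
      "\<And>x z. x \<in> X \<Longrightarrow> z \<in> R x \<Longrightarrow> R z = R x"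
    and R': "\<And>x. x \<in> X \<Longrightarrow> R' x = {z \<in> R x. z \<in> B \<longleftrightarrow> x \<in> B}"
  defines "\<phi> \<equiv> \<lambda>A. hellinger_on P Q A + (hellinger_on P Q A)\<^sup>2"
  shows "(\<Sum>x\<in>X. P x * \<phi> (R x))
    \<le> 15/2 * (\<Sum>x\<in>X. P x * sign_gap (sum P (R x \<inter> B) / sum P (R x)) (sum Q (R x \<inter> B) / sum Q (R x)))
      + (\<Sum>x\<in>X. P x * \<phi> (R' x))"
proof -
  let ?g = "\<lambda>x. sign_gap (sum P (R x \<inter> B) / sum P (R x)) (sum Q (R x \<inter> B) / sum Q (R x))"
  let ?avg = "\<lambda>x. (\<Sum>z\<in>R x. P z * \<phi> (R' z)) / sum P (R x)"
  have finR: "finite (R x)" if "x \<in> X" for x using R(1)[OF that] fin finite_subset by blast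
  have pos: "0 < sum f (R x)" if "x \<in> X" "0 < f x" "\<And>x. x \<in> X \<Longrightarrow> 0 \<le> f x" for x and f :: "_ \<Rightarrow> real"
    using that R(1,2)[OF that(1)] finR[OF that(1)] by (intro sum_pos2[of _ x]) auto
  have "P x * \<phi> (R x) \<le> P x * (15/2 * ?g x + ?avg x)" if x: "x \<in> X" for x
  proof (cases "P x = 0")
    case False
    then have Px: "0 < P x" using P[OF x] by simp
    have sub: "R x \<subseteq> X" using R x by blast
    have "(\<Sum>z\<in>R x. P z * \<phi> (R' z)) = (\<Sum>z\<in>R x \<inter> B. P z * \<phi> (R' z)) + (\<Sum>z\<in>R x - B. P z * \<phi> (R' z))"
      using finR[OF x] by (rule sum.Int_Diff)
    also have "(\<Sum>z\<in>R x \<inter> B. P z * \<phi> (R' z)) = (\<Sum>z\<in>R x \<inter> B. P z * \<phi> (R x \<inter> B))"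
    proof (intro sum.cong refl)
      fix z assume z: "z \<in> R x \<inter> B"
      then have "R' z = R x \<inter> B" using R(3)[OF x, of z] R'[of z] sub by auto
      then show "P z * \<phi> (R' z) = P z * \<phi> (R x \<inter> B)" by simp
    qed
    also have "(\<Sum>z\<in>R x - B. P z * \<phi> (R' z)) = (\<Sum>z\<in>R x - B. P z * \<phi> (R x - B))"
    proof (intro sum.cong refl)
      fix z assume z: "z \<in> R x - B"
      then have "R' z = R x - B" using R(3)[OF x, of z] R'[of z] sub by auto
      then show "P z * \<phi> (R' z) = P z * \<phi> (R x - B)" by simp
    qed
    finally have "?avg x = sum P (R x \<inter> B) / sum P (R x) * \<phi> (R x \<inter> B) + sum P (R x - B) / sum P (R x) * \<phi> (R x - B)"
      by (simp add: sum_distrib_right[symmetric] add_divide_distrib)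
    moreover have "\<phi> (R x) \<le> 15/2 * ?g x + sum P (R x \<inter> B) / sum P (R x) * \<phi> (R x \<inter> B) + sum P (R x - B) / sum P (R x) * \<phi> (R x - B)"
      unfolding \<phi>_def
      by (rule hellinger_split) (use finR x sub P Q Px ac pos in auto)
    ultimately show ?thesis using Px by (intro mult_left_mono) auto
  qed simp
  then have "(\<Sum>x\<in>X. P x * \<phi> (R x)) \<le> (\<Sum>x\<in>X. P x * (15/2 * ?g x + ?avg x))"
    by (rule sum_mono)
  also have "\<dots> = 15/2 * (\<Sum>x\<in>X. P x * ?g x) + (\<Sum>x\<in>X. P x * ?avg x)"
    by (simp add: algebra_simps sum.distrib sum_distrib_left)
  \<comment> \<open>Averaging within classes preserves the total: after exchanging the sums, each
    \<open>z\<close> receives the weight of its class divided by that same weight. If this weight is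
    0, then \<open>P z = 0\<close> as well.\<close>
  also have "(\<Sum>x\<in>X. P x * ?avg x) = (\<Sum>z\<in>X. P z * \<phi> (R' z))"
  proof -
    have "(\<Sum>x\<in>X. P x * ?avg x) = (\<Sum>x\<in>X. \<Sum>z\<in>X. if z \<in> R x then P x * (P z * \<phi> (R' z)) / sum P (R x) else 0)"
    proof (intro sum.cong refl)
      fix x assume x: "x \<in> X"
      have "(\<Sum>z\<in>X. if z \<in> R x then P x * (P z * \<phi> (R' z)) / sum P (R x) else 0)
          = (\<Sum>z\<in>X \<inter> R x. P x * (P z * \<phi> (R' z)) / sum P (R x))"
        using fin by (simp add: sum.inter_restrict)
      also have "X \<inter> R x = R x" using R x by blast
      finally show "P x * ?avg x = (\<Sum>z\<in>X. if z \<in> R x then P x * (P z * \<phi> (R' z)) / sum P (R x) else 0)"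
        by (simp add: sum_distrib_left sum_divide_distrib)
    qed
    also have "\<dots> = (\<Sum>z\<in>X. \<Sum>x\<in>X. if z \<in> R x then P x * (P z * \<phi> (R' z)) / sum P (R x) else 0)"
      by (rule sum.swap)
    also have "\<dots> = (\<Sum>z\<in>X. P z * \<phi> (R' z))"
    proof (intro sum.cong refl)
      fix z assume z: "z \<in> X"
      have eq: "z \<in> R x \<longleftrightarrow> x \<in> R z" if "x \<in> X" for x using R z that by metis
      have "(\<Sum>x\<in>X. if z \<in> R x then P x * (P z * \<phi> (R' z)) / sum P (R x) else 0)
          = (\<Sum>x\<in>X. if x \<in> R z then P x * (P z * \<phi> (R' z)) / sum P (R z) else 0)"
      proof (intro sum.cong refl if_cong)
        fix x assume x: "x \<in> X"
        show "z \<in> R x \<longleftrightarrow> x \<in> R z" using eq[OF x] .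
        assume "x \<in> R z"
        then have "R x = R z" using R(3) z by blast
        then show "P x * (P z * \<phi> (R' z)) / sum P (R x) = P x * (P z * \<phi> (R' z)) / sum P (R z)" by simp
      qed
      also have "\<dots> = (\<Sum>x\<in>X \<inter> R z. P x * (P z * \<phi> (R' z)) / sum P (R z))"
        using fin by (simp add: sum.inter_restrict)
      also have "X \<inter> R z = R z" using R z by blast
      also have "(\<Sum>x\<in>R z. P x * (P z * \<phi> (R' z)) / sum P (R z)) = sum P (R z) * (P z * \<phi> (R' z)) / sum P (R z)"
        by (simp add: sum_distrib_right sum_divide_distrib)
      also have "\<dots> = P z * \<phi> (R' z)"
      proof (cases "P z = 0")
        case False
        then show ?thesis using pos[OF z, of P] P z by (simp add: less_le)
      qed simp
      finally show "(\<Sum>x\<in>X. if z \<in> R x then P x * (P z * \<phi> (R' z)) / sum P (R x) else 0) = P z * \<phi> (R' z)" .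
    qed
    finally show ?thesis .
  qed
  finally show ?thesis .
qed

text \<open>Each difference of probabilities factors into difference and sum of square roots;
  Cauchy-Schwarz applies, the squared differences adding up to \<open>2 * H\<close> and the squared
  sums to at most 4. The event is bounded crudely by the whole L1 distance.\<close>

lemma tv_dist_le_hellinger:
  assumes fin: "finite X" and supp: "set_pmf \<mu> \<subseteq> X" "set_pmf \<nu> \<subseteq> X"
  shows "(tv_dist \<mu> \<nu>)\<^sup>2 \<le> 8 * hellinger_on (pmf \<mu>) (pmf \<nu>) X"
proof -
  let ?a = "\<lambda>x. sqrt (pmf \<mu> x)" and ?b = "\<lambda>x. sqrt (pmf \<nu> x)"
  have s1: "(\<Sum>x\<in>X. pmf \<mu> x) = 1" "(\<Sum>x\<in>X. pmf \<nu> x) = 1"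
    using sum_pmf_eq_1 fin supp by blast+
  define H where "H = hellinger_on (pmf \<mu>) (pmf \<nu>) X"
  have H: "H = 1 - (\<Sum>x\<in>X. ?a x * ?b x)"
    unfolding H_def hellinger_on_def affinity_def s1 by (simp add: real_sqrt_mult)
  have L1: "(\<Sum>x\<in>X. (?a x - ?b x)\<^sup>2) = 2 * H"
    unfolding H by (simp add: power2_diff sum.distrib sum_subtractf s1 sum_distrib_left algebra_simps)
  have "(\<Sum>x\<in>X. (?a x + ?b x)\<^sup>2) \<le> (\<Sum>x\<in>X. 2 * pmf \<mu> x + 2 * pmf \<nu> x)"
  proof (rule sum_mono)
    fix x
    have "0 \<le> (?a x - ?b x)\<^sup>2" by simp
    then show "(?a x + ?b x)\<^sup>2 \<le> 2 * pmf \<mu> x + 2 * pmf \<nu> x" by (simp add: power2_sum power2_diff)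
  qed
  also have "\<dots> = 4" by (simp add: sum.distrib sum_distrib_left[symmetric] s1)
  finally have L2: "(\<Sum>x\<in>X. (?a x + ?b x)\<^sup>2) \<le> 4" .
  have "\<bar>measure_pmf.prob \<mu> S - measure_pmf.prob \<nu> S\<bar> \<le> sqrt (8 * H)" for S
  proof -
    have m: "measure_pmf.prob p S = sum (pmf p) (X \<inter> S)" if "set_pmf p \<subseteq> X" for p
    proof -
      have "measure_pmf.prob p S = measure_pmf.prob p (X \<inter> S)"
        using that by (intro measure_pmf.finite_measure_eq_AE) (auto simp: AE_measure_pmf_iff)
      then show ?thesis using fin by (simp add: measure_measure_pmf_finite)
    qed
    have "\<bar>measure_pmf.prob \<mu> S - measure_pmf.prob \<nu> S\<bar> = \<bar>\<Sum>x\<in>X \<inter> S. pmf \<mu> x - pmf \<nu> x\<bar>"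
      using m supp by (simp add: sum_subtractf)
    also have "\<dots> \<le> (\<Sum>x\<in>X \<inter> S. \<bar>pmf \<mu> x - pmf \<nu> x\<bar>)" by (rule sum_abs)
    also have "\<dots> \<le> (\<Sum>x\<in>X. \<bar>pmf \<mu> x - pmf \<nu> x\<bar>)" using fin by (intro sum_mono2) auto
    also have "\<dots> = (\<Sum>x\<in>X. \<bar>?a x - ?b x\<bar> * \<bar>?a x + ?b x\<bar>)"
    proof (intro sum.cong refl)
      fix x
      have "pmf \<mu> x - pmf \<nu> x = (?a x)\<^sup>2 - (?b x)\<^sup>2" by simp
      also have "\<dots> = (?a x - ?b x) * (?a x + ?b x)" by (simp add: power2_eq_square algebra_simps)
      finally show "\<bar>pmf \<mu> x - pmf \<nu> x\<bar> = \<bar>?a x - ?b x\<bar> * \<bar>?a x + ?b x\<bar>" by (simp add: abs_mult)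
    qed
    also have "\<dots> \<le> L2_set (\<lambda>x. ?a x - ?b x) X * L2_set (\<lambda>x. ?a x + ?b x) X"
      by (rule L2_set_mult_ineq)
    also have "\<dots> \<le> sqrt (2 * H) * sqrt 4"
      unfolding L2_set_def L1 using L2 L1[symmetric]
      by (intro mult_left_mono real_sqrt_le_mono) (auto intro!: sum_nonneg)
    also have "\<dots> = sqrt (2 * H * 4)" by (rule real_sqrt_mult[symmetric])
    also have "2 * H * 4 = 8 * H" by simp
    finally show ?thesis .
  qed
  then have "tv_dist \<mu> \<nu> \<le> sqrt (8 * H)"
    unfolding tv_dist_def by (intro cSUP_least) auto
  moreover have "0 \<le> tv_dist \<mu> \<nu>"
    unfolding tv_dist_def
    by (rule cSUP_upper2[of _ _ "{}"])
       (auto intro!: bdd_aboveI2[of _ _ 1] add_increasing2 simp: abs_le_iff algebra_simps)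
  moreover have "0 \<le> H" unfolding H_def by (intro hellinger_on_bounds) auto
  ultimately show ?thesis unfolding H_def[symmetric]
    using power_mono[of "tv_dist \<mu> \<nu>" "sqrt (8 * H)" 2] by simp
qed

section \<open>Sign test by betting\<close>

text \<open>
  The capital of a gambler staking the fraction \<open>c\<close> on the sign of \<open>a - b\<close> in every round. For equal biases
  its expectation is 1, so Markov's inequality controls false alarms. For the power of the test, Markov's
  inequality is applied to the inverse of the capital.
\<close>

definition bet :: "real \<Rightarrow> (bool \<times> bool) list \<Rightarrow> real" where
  "bet c zs = (\<Prod>z\<leftarrow>zs. 1 + c * (of_bool (fst z) - of_bool (snd z)))"

text \<open>A good stake depends on the unknown biases, so the capitals for all stakes
  \<open>1 / l\<close> of both signs are added up. Starting at \<open>l = 2\<close> keeps every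
  capital positive.\<close>

definition sign_test :: "nat \<Rightarrow> real \<Rightarrow> (bool \<times> bool) list \<Rightarrow> bool" where
  "sign_test L T zs \<longleftrightarrow> (\<Sum>l=2..L. bet (1 / real l) zs + bet (- 1 / real l) zs) \<ge> T"

lemma finite_set_replicate_pmf:
  "finite (set_pmf p) \<Longrightarrow> finite (set_pmf (replicate_pmf m p))"
  unfolding set_replicate_pmf lists_eq_set using finite_lists_length_eq[of "set_pmf p" m] by simp

lemma expectation_replicate_pmf_prod_list:
  fixes f :: "'b \<Rightarrow> real"
  assumes fin: "finite (set_pmf p)"
  shows "measure_pmf.expectation (replicate_pmf m p) (\<lambda>zs. prod_list (map f zs))
    = (measure_pmf.expectation p f) ^ m"
proof (induction m)
  case (Suc m)
  have "measure_pmf.expectation (replicate_pmf (Suc m) p) (\<lambda>zs. prod_list (map f zs))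
      = (\<Sum>a\<in>set_pmf p. pmf p a * measure_pmf.expectation (map_pmf ((#) a) (replicate_pmf m p)) (\<lambda>zs. prod_list (map f zs)))"
    using fin finite_set_replicate_pmf[OF fin]
    by (subst replicate_pmf.simps, subst pmf_expectation_bind[of "set_pmf p"]) (auto simp: map_pmf_def)
  also have "\<dots> = (\<Sum>a\<in>set_pmf p. pmf p a * f a) * (measure_pmf.expectation p f) ^ m"
    by (simp add: Suc sum_distrib_right mult.assoc)
  also have "(\<Sum>a\<in>set_pmf p. pmf p a * f a) = measure_pmf.expectation p f"
    by (subst integral_measure_pmf_real[OF fin]) (auto simp: mult.commute)
  finally show ?case by simp
qed simp

lemma expectation_pair_bool:
  fixes f :: "bool \<times> bool \<Rightarrow> real" and a b :: "bool pmf"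
  defines "p \<equiv> pmf a True" and "q \<equiv> pmf b True"
  shows "measure_pmf.expectation (pair_pmf a b) f = p * q * f (True, True) + p * (1 - q) * f (True, False)
    + (1 - p) * q * f (False, True) + (1 - p) * (1 - q) * f (False, False)"
proof -
  have "measure_pmf.expectation (pair_pmf a b) f = (\<Sum>z\<in>UNIV. f z * pmf (pair_pmf a b) z)"
    by (rule integral_measure_pmf_real) auto
  also have "\<dots> = (\<Sum>x\<in>UNIV. \<Sum>y\<in>UNIV. f (x, y) * (pmf a x * pmf b y))"
    unfolding sum.cartesian_product UNIV_Times_UNIV by (intro sum.cong) (auto simp: pmf_pair)
  also have "\<dots> = p * q * f (True, True) + p * (1 - q) * f (True, False)
    + (1 - p) * q * f (False, True) + (1 - p) * (1 - q) * f (False, False)"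
    unfolding UNIV_bool by (simp add: pmf_False_conv_True p_def q_def algebra_simps)
  finally show ?thesis .
qed

lemma bet_pos: "\<bar>c\<bar> < 1 \<Longrightarrow> 0 < bet c zs"
  unfolding bet_def by (induction zs) (auto simp: of_bool_def)

lemma expectation_bet_null:
  "measure_pmf.expectation (replicate_pmf m (pair_pmf a a)) (bet c) = 1"
proof -
  have "measure_pmf.expectation (replicate_pmf m (pair_pmf a a)) (bet c)
      = (measure_pmf.expectation (pair_pmf a a) (\<lambda>z. 1 + c * (of_bool (fst z) - of_bool (snd z)))) ^ m"
    unfolding bet_def by (rule expectation_replicate_pmf_prod_list) simp
  then show ?thesis by (simp add: expectation_pair_bool algebra_simps)
qed

text \<open>At most \<open>2 * L\<close> capitals are summed, each of expectation 1.\<close>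

lemma sign_test_null:
  assumes "0 < T"
  shows "measure_pmf.prob (replicate_pmf m (pair_pmf a a)) {zs. sign_test L T zs} \<le> 2 * L / T"
proof -
  let ?M = "replicate_pmf m (pair_pmf a a)"
  let ?W = "\<lambda>zs. (\<Sum>l=2..L. bet (1 / real l) zs + bet (- 1 / real l) zs)"
  have int: "integrable (measure_pmf ?M) f" for f :: "_ \<Rightarrow> real"
    by (intro integrable_measure_pmf_finite finite_set_replicate_pmf) simp
  have "measure (measure_pmf ?M) {zs \<in> space (measure_pmf ?M). T \<le> ?W zs} \<le> measure_pmf.expectation ?M ?W / T"
  proof (rule integral_Markov_inequality_measure[OF int, of "{}"])
    show "AE zs in measure_pmf ?M. 0 \<le> ?W zs"
      by (intro AE_I2 sum_nonneg add_nonneg_nonneg less_imp_le bet_pos) auto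
  qed (use assms in auto)
  also have "measure_pmf.expectation ?M ?W = (\<Sum>l=2..L. 1 + 1)"
    using int by (subst Bochner_Integration.integral_sum) (auto simp: expectation_bet_null)
  also have "\<dots> / T \<le> 2 * L / T" using assms by (intro divide_right_mono) auto
  finally show ?thesis by (simp add: sign_test_def)
qed

text \<open>The stake has the favourable sign and its size is between a quarter and a half of
  \<open>\<bar>p - q\<bar> / s\<close>. The upper limit lets the second-order loss
  \<open>s * c\<^sup>2\<close> consume at most half of the gain \<open>c * (p - q)\<close>; by the
  lower limit the other half is at least an eighth of the gap.\<close>

lemma expectation_inverse_bet_le:
  fixes c :: real and a b :: "bool pmf"
  defines "p \<equiv> pmf a True" and "q \<equiv> pmf b True"
  defines "s \<equiv> p + q - 2 * p * q"
  assumes c: "\<bar>c\<bar> < 1"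
    and low: "\<bar>p - q\<bar> \<le> 4 * \<bar>c\<bar> * s" and up: "2 * \<bar>c\<bar> * s \<le> \<bar>p - q\<bar>"
    and sgn: "c * (p - q) = \<bar>c\<bar> * \<bar>p - q\<bar>"
  shows "measure_pmf.expectation (pair_pmf a b) (\<lambda>z. inverse (1 + c * (of_bool (fst z) - of_bool (snd z))))
    \<le> 1 - sign_gap p q / 8"
proof -
  have pq: "0 \<le> p" "p \<le> 1" "0 \<le> q" "q \<le> 1" unfolding p_def q_def by (simp_all add: pmf_le_1)
  have nz: "1 + c > 0" "1 - c > 0" using c by auto
  have c2: "0 < 1 - c\<^sup>2" "1 - c\<^sup>2 \<le> 1" using c by (auto simp: abs_square_less_1)
  have "measure_pmf.expectation (pair_pmf a b) (\<lambda>z. inverse (1 + c * (of_bool (fst z) - of_bool (snd z))))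
      = p * q + p * (1 - q) / (1 + c) + (1 - p) * q / (1 - c) + (1 - p) * (1 - q)"
    unfolding expectation_pair_bool by (simp add: p_def q_def divide_inverse)
  also have "\<dots> = 1 + (s * c\<^sup>2 - c * (p - q)) / (1 - c\<^sup>2)"
  proof -
    have "1 - c\<^sup>2 = (1 + c) * (1 - c)" by (simp add: power2_eq_square algebra_simps)
    then show ?thesis unfolding s_def using nz
      by (simp add: divide_simps) (simp add: power2_eq_square algebra_simps)
  qed
  also have "(s * c\<^sup>2 - c * (p - q)) / (1 - c\<^sup>2) \<le> - sign_gap p q / 8"
  proof -
    have s0: "0 \<le> s" using discordance_bounds(1)[OF pq] unfolding s_def by linarith
    have "s * c\<^sup>2 = (2 * \<bar>c\<bar> * s) * \<bar>c\<bar> / 2" by (simp add: power2_eq_square)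
    also have "\<dots> \<le> \<bar>p - q\<bar> * \<bar>c\<bar> / 2" using up by (intro divide_right_mono mult_right_mono) auto
    finally have 1: "s * c\<^sup>2 - c * (p - q) \<le> - (\<bar>p - q\<bar> * \<bar>c\<bar> / 2)" using sgn by (simp add: algebra_simps)
    have 2: "sign_gap p q / 8 \<le> \<bar>p - q\<bar> * \<bar>c\<bar> / 2"
    proof (cases "s = 0")
      case False
      with s0 have "0 < s" by simp
      have "\<bar>p - q\<bar> * \<bar>p - q\<bar> \<le> \<bar>p - q\<bar> * (4 * \<bar>c\<bar> * s)" using low by (intro mult_left_mono) auto
      then show ?thesis unfolding sign_gap_def s_def[symmetric] using \<open>0 < s\<close>
        by (simp add: divide_simps power2_eq_square algebra_simps)
    qed (simp add: sign_gap_def s_def[symmetric])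
    have "(s * c\<^sup>2 - c * (p - q)) / (1 - c\<^sup>2) \<le> - (\<bar>p - q\<bar> * \<bar>c\<bar> / 2) / (1 - c\<^sup>2)"
      using 1 c2 by (intro divide_right_mono) auto
    also have "\<dots> \<le> - (\<bar>p - q\<bar> * \<bar>c\<bar> / 2)"
    proof -
      have "\<bar>p - q\<bar> * \<bar>c\<bar> / 2 * (1 - c\<^sup>2) \<le> \<bar>p - q\<bar> * \<bar>c\<bar> / 2"
        using c2 by (intro mult_right_le_one_le) auto
      then have "\<bar>p - q\<bar> * \<bar>c\<bar> / 2 \<le> (\<bar>p - q\<bar> * \<bar>c\<bar> / 2) / (1 - c\<^sup>2)"
        using c2 by (simp only: pos_le_divide_eq)
      then show ?thesis by simp
    qed
    finally show ?thesis using 2 by simp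
  qed
  finally show ?thesis by simp
qed

text \<open>One of the stakes suits the biases. Its inverse capital has expectation at most
  \<open>exp (- \<delta> * m / 8)\<close>, so by Markov's inequality it is below
  \<open>1 / T\<close> with probability at least 1/2; the remaining capitals are positive and only
  help.\<close>

lemma sign_test_power:
  fixes a b :: "bool pmf" and \<delta> T :: real
  defines "p \<equiv> pmf a True" and "q \<equiv> pmf b True"
  assumes gap: "\<delta> \<le> sign_gap p q" and \<delta>: "0 < \<delta>" and L: "4 / \<delta> \<le> real L"
    and T: "0 < T" and m: "T * exp (- \<delta> * m / 8) \<le> 1/2"
  shows "measure_pmf.prob (replicate_pmf m (pair_pmf a b)) {zs. sign_test L T zs} \<ge> 1/2"
proof -
  let ?M = "replicate_pmf m (pair_pmf a b)"
  define s where "s = p + q - 2 * p * q"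
  define r where "r = \<bar>p - q\<bar> / s"
  have pq: "0 \<le> p" "p \<le> 1" "0 \<le> q" "q \<le> 1" unfolding p_def q_def by (simp_all add: pmf_le_1)
  have s: "0 < s" "s \<le> 1" "\<bar>p - q\<bar> \<le> s"
  proof -
    show "\<bar>p - q\<bar> \<le> s" "s \<le> 1" using discordance_bounds[OF pq] unfolding s_def by auto
    moreover have "s \<noteq> 0" using gap \<delta> unfolding sign_gap_def s_def by auto
    ultimately show "0 < s" by linarith
  qed
  have r1: "r \<le> 1" unfolding r_def using s by (simp add: divide_le_eq_1)
  have "sign_gap p q = r * \<bar>p - q\<bar>"
    unfolding r_def sign_gap_def s_def[symmetric] by (simp add: power2_eq_square)
  also have "\<dots> \<le> r * 1" using s unfolding r_def by (intro mult_left_mono) auto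
  finally have r: "\<delta> \<le> r" using gap by simp
  then have r0: "0 < r" using \<delta> by simp
  \<comment> \<open>Rounding keeps \<open>1 / l\<close> between \<open>r / 4\<close> and
    \<open>r / 2\<close>, the range required of the stake. From \<open>\<delta> \<le> r\<close> it
    follows that \<open>l \<le> 4 / \<delta>\<close>, so this stake is among those tried.\<close>
  define l where "l = nat \<lceil>2 / r\<rceil>"
  have l: "2 / r \<le> real l" "real l \<le> 4 / r"
  proof -
    have "1 \<le> 1 / r" using r0 r1 by simp
    then have "1 \<le> 2 / r" "2 / r + 1 \<le> 4 / r" by (simp_all add: field_simps)
    then show "2 / r \<le> real l" "real l \<le> 4 / r" unfolding l_def by linarith+
  qed
  have "2 \<le> 2 / r" using r0 r1 by (simp add: field_simps)
  then have l2: "2 \<le> l" using l by linarith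
  have "4 / r \<le> 4 / \<delta>" using r \<delta> by (simp add: frac_le)
  then have lL: "l \<le> L" using l L by linarith
  define c where "c = (if q \<le> p then 1 / real l else - 1 / real l)"
  have absc: "\<bar>c\<bar> = 1 / real l" unfolding c_def by simp
  have c1: "\<bar>c\<bar> < 1" unfolding absc using l2 by simp
  have rs: "\<bar>p - q\<bar> = r * s" unfolding r_def using s by simp
  have up: "2 * \<bar>c\<bar> * s \<le> \<bar>p - q\<bar>"
    unfolding rs absc using l(1) l2 r0 s by (intro mult_right_mono) (auto simp: field_simps)
  have low: "\<bar>p - q\<bar> \<le> 4 * \<bar>c\<bar> * s"
    unfolding rs absc using l(2) l2 r0 s by (intro mult_right_mono) (auto simp: field_simps)
  have sgn: "c * (p - q) = \<bar>c\<bar> * \<bar>p - q\<bar>"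
    unfolding c_def by (simp add: diff_divide_distrib)
  define iW where "iW = (\<lambda>zs. prod_list (map (\<lambda>z. inverse (1 + c * (of_bool (fst z) - of_bool (snd z)))) zs))"
  have iW: "iW zs = inverse (bet c zs)" for zs
    unfolding iW_def bet_def by (induction zs) simp_all
  have int: "integrable (measure_pmf ?M) f" for f :: "_ \<Rightarrow> real"
    by (intro integrable_measure_pmf_finite finite_set_replicate_pmf) simp
  let ?E = "measure_pmf.expectation (pair_pmf a b) (\<lambda>z. inverse (1 + c * (of_bool (fst z) - of_bool (snd z))))"
  have E0: "0 \<le> ?E" using c1 by (intro integral_nonneg_AE AE_I2) (auto simp: of_bool_def)
  have "?E \<le> 1 - sign_gap p q / 8"
    unfolding p_def q_def
    by (rule expectation_inverse_bet_le) (use c1 up low sgn in \<open>auto simp: p_def q_def s_def\<close>)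
  also have "\<dots> \<le> 1 + (- \<delta> / 8)" using gap by simp
  also have "\<dots> \<le> exp (- \<delta> / 8)" by (rule exp_ge_add_one_self)
  finally have "?E ^ m \<le> exp (- \<delta> / 8) ^ m" using E0 by (intro power_mono)
  also have "\<dots> = exp (- \<delta> * m / 8)" by (simp add: exp_of_nat_mult[symmetric])
  finally have Em: "?E ^ m \<le> exp (- \<delta> * m / 8)" .
  have "measure (measure_pmf ?M) {zs \<in> space (measure_pmf ?M). 1 / T \<le> iW zs} \<le> measure_pmf.expectation ?M iW / (1 / T)"
  proof (rule integral_Markov_inequality_measure[OF int, of "{}"])
    show "AE zs in measure_pmf ?M. 0 \<le> iW zs"
      unfolding iW by (intro AE_I2) (simp add: bet_pos[OF c1] less_imp_le)
  qed (use T in auto)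
  also have "measure_pmf.expectation ?M iW = ?E ^ m"
    unfolding iW_def by (rule expectation_replicate_pmf_prod_list) simp
  also have "?E ^ m / (1 / T) \<le> 1/2"
  proof -
    have "?E ^ m / (1 / T) = T * ?E ^ m" by simp
    also have "\<dots> \<le> T * exp (- \<delta> * m / 8)" using Em T by (intro mult_left_mono) auto
    finally show ?thesis using m by linarith
  qed
  finally have half: "measure_pmf.prob ?M {zs. 1 / T \<le> iW zs} \<le> 1/2" by simp
  have "zs \<in> {zs. 1 / T \<le> iW zs}" if "\<not> sign_test L T zs" for zs
  proof -
    let ?f = "\<lambda>l. bet (1 / real l) zs + bet (- 1 / real l) zs"
    have pos: "0 < bet (1 / real k) zs" "0 < bet (- 1 / real k) zs" if "2 \<le> k" for k
      using that by (auto intro!: bet_pos)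
    have "bet c zs \<le> ?f l" using pos[OF l2] unfolding c_def by auto
    also have "\<dots> \<le> (\<Sum>l=2..L. ?f l)"
    proof (intro member_le_sum)
      show "0 \<le> ?f k" if "k \<in> {2..L} - {l}" for k using pos[of k] that by simp
    qed (use l2 lL in auto)
    finally have "bet c zs < T" using that unfolding sign_test_def by simp
    then show ?thesis using bet_pos[OF c1, of zs] T by (simp add: iW divide_inverse)
  qed
  then have "- {zs. sign_test L T zs} \<subseteq> {zs. 1 / T \<le> iW zs}" by blast
  then have "measure_pmf.prob ?M (- {zs. sign_test L T zs}) \<le> 1/2"
    by (intro order_trans[OF measure_pmf.finite_measure_mono half]) simp_all
  moreover have "measure_pmf.prob ?M (- {zs. sign_test L T zs}) = 1 - measure_pmf.prob ?M {zs. sign_test L T zs}"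
    using measure_pmf.prob_compl[of "{zs. sign_test L T zs}" ?M] by (simp add: Compl_eq_Diff_UNIV)
  ultimately show ?thesis by simp
qed

section \<open>Composition of oracle algorithms\<close>

primrec and_then :: "('q, 'r) oracle_alg \<Rightarrow> ('q, 'r) oracle_alg \<Rightarrow> ('q, 'r) oracle_alg" where
  "and_then (Output b) S = (if b then S else Output False)"
| "and_then (Coin p) S = Coin (map_pmf (\<lambda>t. and_then t S) p)"
| "and_then (Query a c) S = Query a (\<lambda>r. and_then (c r) S)"

lemma run_and_then:
  "run orc (and_then T S) = bind_pmf (run orc T) (\<lambda>b. if b then run orc S else return_pmf False)"
proof (induction T)
  case (Coin p)
  have "run orc (and_then (Coin p) S) = bind_pmf p (\<lambda>t. run orc (and_then t S))"
    by (simp add: join_eq_bind_pmf bind_map_pmf pmf.map_comp o_def)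
  also have "\<dots> = bind_pmf p (\<lambda>t. bind_pmf (run orc t) (\<lambda>b. if b then run orc S else return_pmf False))"
    using Coin by (intro bind_pmf_cong) auto
  also have "\<dots> = bind_pmf (run orc (Coin p)) (\<lambda>b. if b then run orc S else return_pmf False)"
    by (simp add: join_eq_bind_pmf bind_map_pmf bind_assoc_pmf)
  finally show ?case .
qed (auto simp: bind_return_pmf bind_assoc_pmf)

lemma pmf_run_and_then:
  "pmf (run orc (and_then T S)) True = pmf (run orc T) True * pmf (run orc S) True"
proof -
  have "pmf (run orc (and_then T S)) True
      = (\<Sum>b\<in>UNIV. pmf (if b then run orc S else return_pmf False) True * pmf (run orc T) b)"
    unfolding run_and_then pmf_bind by (rule integral_measure_pmf_real) auto
  then show ?thesis by (simp add: UNIV_bool)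
qed

lemma queries_at_most_mono:
  "queries_at_most q T \<Longrightarrow> q \<le> q' \<Longrightarrow> queries_at_most q' T"
proof (induction arbitrary: q' rule: queries_at_most.induct)
  case (3 q c a)
  then obtain q'' where "q' = Suc q''" "q \<le> q''" by (cases q') auto
  with 3 show ?case by (auto intro: queries_at_most.intros)
qed (auto intro: queries_at_most.intros)

lemma queries_at_most_and_then:
  "queries_at_most q T \<Longrightarrow> queries_at_most q' S \<Longrightarrow> queries_at_most (q + q') (and_then T S)"
proof (induction rule: queries_at_most.induct)
  case (1 q b)
  then show ?case by (auto intro: queries_at_most.intros queries_at_most_mono)
qed (auto intro!: queries_at_most.intros)

lemma all_queries_and_then:
  "all_queries P T \<Longrightarrow> all_queries P S \<Longrightarrow> all_queries P (and_then T S)"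
  by (induction rule: all_queries.induct) (auto intro!: all_queries.intros)

definition accept_all :: "('q, 'r) oracle_alg list \<Rightarrow> ('q, 'r) oracle_alg" where
  "accept_all Ts = foldr and_then Ts (Output True)"

lemma pmf_run_accept_all:
  "pmf (run orc (accept_all Ts)) True = (\<Prod>T\<leftarrow>Ts. pmf (run orc T) True)"
  unfolding accept_all_def by (induction Ts) (simp_all add: pmf_run_and_then)

lemma queries_at_most_accept_all:
  "(\<And>q T. (q, T) \<in> set zs \<Longrightarrow> queries_at_most q T)
    \<Longrightarrow> queries_at_most (\<Sum>z\<leftarrow>zs. fst z) (accept_all (map snd zs))"
  unfolding accept_all_def
  by (induction zs) (auto intro!: queries_at_most.intros queries_at_most_and_then)

lemma all_queries_accept_all:
  "(\<And>T. T \<in> set Ts \<Longrightarrow> all_queries P T) \<Longrightarrow> all_queries P (accept_all Ts)"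
  unfolding accept_all_def by (induction Ts) (auto intro: all_queries.intros all_queries_and_then)

text \<open>An \<open>oracle_alg\<close> outputs only a Boolean, hence the list of sampled bits is
  passed on to a continuation \<open>k\<close>.\<close>

primrec paired_samples ::
  "nat \<Rightarrow> 'q \<Rightarrow> 'q \<Rightarrow> ('r \<Rightarrow> bool) \<Rightarrow> ((bool \<times> bool) list \<Rightarrow> ('q, 'r) oracle_alg) \<Rightarrow> ('q, 'r) oracle_alg" where
  "paired_samples 0 A B f k = k []"
| "paired_samples (Suc m) A B f k =
     Query A (\<lambda>r. Query B (\<lambda>r'. paired_samples m A B f (\<lambda>zs. k ((f r, f r') # zs))))"

lemma run_paired_samples:
  "run orc (paired_samples m A B f k)
    = bind_pmf (replicate_pmf m (pair_pmf (map_pmf f (orc A)) (map_pmf f (orc B)))) (\<lambda>zs. run orc (k zs))"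
  by (induction m arbitrary: k)
    (simp_all add: bind_return_pmf bind_assoc_pmf pair_pmf_def bind_map_pmf)

lemma queries_at_most_paired_samples:
  "(\<And>zs. queries_at_most q (k zs)) \<Longrightarrow> queries_at_most (2 * m + q) (paired_samples m A B f k)"
  by (induction m arbitrary: k) (auto intro!: queries_at_most.intros)

lemma all_queries_paired_samples:
  "(\<And>zs. all_queries P (k zs)) \<Longrightarrow> P A \<Longrightarrow> P B \<Longrightarrow> all_queries P (paired_samples m A B f k)"
  by (induction m arbitrary: k) (auto intro!: all_queries.intros)

text \<open>Up to \<open>1 / 2 ^ J\<close>, which is at most half of the mean, \<open>g\<close> is
  bounded by the layers \<open>2 / 2 ^ j\<close> on the events \<open>1 / 2 ^ j \<le> g x\<close>.
  If all \<open>J + 1\<close> events were less likely than claimed, the layers would contribute less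
  than the other half.\<close>

lemma dyadic_bucket:
  fixes g :: "'x \<Rightarrow> real"
  assumes fin: "finite (set_pmf D)"
    and g: "\<And>x. x \<in> set_pmf D \<Longrightarrow> 0 \<le> g x" "\<And>x. x \<in> set_pmf D \<Longrightarrow> g x \<le> 1"
    and \<theta>: "\<theta> \<le> measure_pmf.expectation D g" "0 < \<theta>" and J: "1 / 2 ^ J \<le> \<theta> / 2"
  shows "\<exists>j\<le>J. \<theta> * 2 ^ j / (4 * (J + 1)) \<le> measure_pmf.prob D {x. 1 / 2 ^ j \<le> g x}"
proof (rule ccontr)
  assume "\<not> ?thesis"
  then have small: "measure_pmf.prob D {x. 1 / 2 ^ j \<le> g x} < \<theta> * 2 ^ j / (4 * (J + 1))" if "j \<le> J" for j
    using that by auto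
  have int: "integrable (measure_pmf D) f" for f :: "_ \<Rightarrow> real"
    by (intro integrable_measure_pmf_finite fin)
  have pw: "g x \<le> 1 / 2 ^ J + (\<Sum>j\<le>J. 2 / 2 ^ j * indicator {x. 1 / 2 ^ j \<le> g x} x)"
    if x: "x \<in> set_pmf D" for x
  proof (cases "1 / 2 ^ J \<le> g x")
    case True
    \<comment> \<open>Minimality makes \<open>g x\<close> less than twice \<open>1 / 2 ^ j\<close>,
      or \<open>j = 0\<close> and \<open>g x \<le> 1\<close>; one layer alone therefore covers
      \<open>g x\<close>.\<close>
    define j where "j = (LEAST j. 1 / 2 ^ j \<le> g x)"
    have j: "1 / 2 ^ j \<le> g x" "j \<le> J" unfolding j_def using True by (auto intro: LeastI Least_le)
    have "g x \<le> 2 / 2 ^ j"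
    proof (cases j)
      case 0
      then show ?thesis using g x by (simp add: order_trans[of _ 1])
    next
      case (Suc k)
      then have "\<not> 1 / 2 ^ k \<le> g x" using not_less_Least[of k "\<lambda>j. 1 / 2 ^ j \<le> g x"] unfolding j_def by auto
      then show ?thesis using Suc by simp
    qed
    also have "\<dots> = 2 / 2 ^ j * indicator {x. 1 / 2 ^ j \<le> g x} x" using j by simp
    also have "\<dots> \<le> (\<Sum>j\<le>J. 2 / 2 ^ j * indicator {x. 1 / 2 ^ j \<le> g x} x)"
      using j by (intro member_le_sum[of j "{..J}"]) auto
    also have "\<dots> \<le> 1 / 2 ^ J + \<dots>" by simp
    finally show ?thesis .
  next
    case False
    moreover have "0 \<le> (\<Sum>j\<le>J. 2 / 2 ^ j * (indicator {x. 1 / 2 ^ j \<le> g x} x :: real))"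
      by (intro sum_nonneg) auto
    ultimately show ?thesis by linarith
  qed
  have "measure_pmf.expectation D g
      \<le> measure_pmf.expectation D (\<lambda>x. 1 / 2 ^ J + (\<Sum>j\<le>J. 2 / 2 ^ j * indicator {x. 1 / 2 ^ j \<le> g x} x))"
    using pw by (intro integral_mono_AE int) (simp only: AE_measure_pmf_iff, blast)
  also have "\<dots> = 1 / 2 ^ J + (\<Sum>j\<le>J. 2 / 2 ^ j * measure_pmf.prob D {x. 1 / 2 ^ j \<le> g x})"
    using int by (subst Bochner_Integration.integral_add) (auto simp: Bochner_Integration.integral_sum)
  also have "(\<Sum>j\<le>J. 2 / 2 ^ j * measure_pmf.prob D {x. 1 / 2 ^ j \<le> g x}) < (\<Sum>j\<le>J. \<theta> / (2 * (J + 1)))"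
  proof (intro sum_strict_mono)
    fix j assume "j \<in> {..J}"
    then have "2 / 2 ^ j * measure_pmf.prob D {x. 1 / 2 ^ j \<le> g x} < 2 / 2 ^ j * (\<theta> * 2 ^ j / (4 * (J + 1)))"
      using small[of j] by (intro mult_strict_left_mono) auto
    then show "2 / 2 ^ j * measure_pmf.prob D {x. 1 / 2 ^ j \<le> g x} < \<theta> / (2 * (J + 1))"
      by (simp add: field_simps)
  qed auto
  also have "(\<Sum>j\<le>J. \<theta> / (2 * (J + 1))) = \<theta> / 2" by (simp add: field_simps)
  finally show False using \<theta> J by linarith
qed

section \<open>Bitwise comparison with the product of the marginals\<close>

definition marginal_product :: "nat \<Rightarrow> (nat \<Rightarrow> 'a) pmf \<Rightarrow> (nat \<Rightarrow> 'a) pmf" where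
  "marginal_product n \<mu> = Pi_pmf {1..n} undefined (\<lambda>i. map_pmf (\<lambda>x. x i) \<mu>)"

lemma marginal_product_eq:
  assumes "product_distribution n \<Omega> \<mu>"
  shows "marginal_product n \<mu> = \<mu>"
proof -
  obtain m where \<mu>: "\<mu> = Pi_pmf {1..n} undefined m"
    using assms unfolding product_distribution_def by blast
  show ?thesis
    unfolding marginal_product_def \<mu> by (intro Pi_pmf_cong) (auto simp: Pi_pmf_component)
qed

lemma product_distribution_marginal_product:
  assumes "distribution_over n \<Omega> \<mu>"
  shows "product_distribution n \<Omega> (marginal_product n \<mu>)"
  unfolding product_distribution_def marginal_product_def
  using assms unfolding distribution_over_def
  by (intro exI[of _ "\<lambda>i. map_pmf (\<lambda>x. x i) \<mu>"]) (auto dest!: subsetD)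

lemma PiE_dflt_undefined: "PiE_dflt A undefined B = PiE A B"
  by (auto simp: PiE_dflt_def PiE_def extensional_def)

lemma set_pmf_marginal_product:
  "set_pmf (marginal_product n \<mu>) = PiE {1..n} (\<lambda>i. (\<lambda>x. x i) ` set_pmf \<mu>)"
  unfolding marginal_product_def by (subst set_Pi_pmf) (auto simp: PiE_dflt_undefined o_def)

lemma prob_eq_on_support:
  assumes "\<And>x. x \<in> set_pmf p \<Longrightarrow> x \<in> A \<longleftrightarrow> x \<in> B"
  shows "measure_pmf.prob p A = measure_pmf.prob p B"
  using assms by (intro measure_pmf.finite_measure_eq_AE) (auto simp: AE_measure_pmf_iff)

lemma prob_cond_pmf:
  assumes fin: "finite S" and pos: "measure_pmf.prob p S \<noteq> 0"
  shows "measure_pmf.prob (cond_pmf p S) B = measure_pmf.prob p (S \<inter> B) / measure_pmf.prob p S"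
proof -
  have ne: "set_pmf p \<inter> S \<noteq> {}" using pos by (simp add: measure_pmf_zero_iff)
  have "measure_pmf.prob (cond_pmf p S) B = measure_pmf.prob (cond_pmf p S) (S \<inter> B)"
    by (rule prob_eq_on_support) (simp add: set_cond_pmf[OF ne])
  also have "\<dots> = (\<Sum>x\<in>S \<inter> B. pmf p x / measure_pmf.prob p S)"
    using fin by (simp add: measure_measure_pmf_finite pmf_cond[OF ne])
  also have "\<dots> = measure_pmf.prob p (S \<inter> B) / measure_pmf.prob p S"
    using fin by (simp add: measure_measure_pmf_finite sum_divide_distrib)
  finally show ?thesis .
qed

text \<open>Letters of alphabet \<open>i\<close> have injective codes of \<open>d i\<close> bits;
  not every bit string need be a code. The point \<open>x0\<close> replaces meaningless oracle
  answers.\<close>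

locale bit_coding =
  fixes n :: nat and \<Omega> :: "nat \<Rightarrow> 'a set" and d :: "nat \<Rightarrow> nat"
    and bit_of :: "nat \<Rightarrow> nat \<Rightarrow> 'a \<Rightarrow> bool" and x0 :: "nat \<Rightarrow> 'a"
  assumes finite_alphabet: "i \<in> {1..n} \<Longrightarrow> finite (\<Omega> i)"
    and bits_separate: "\<lbrakk>i \<in> {1..n}; v \<in> \<Omega> i; w \<in> \<Omega> i; \<forall>s<d i. bit_of i s v = bit_of i s w\<rbrakk> \<Longrightarrow> v = w"
    and x0: "x0 \<in> PiE {1..n} \<Omega>"
begin

section \<open>Partitions of the product space by leading bits\<close>

definition points :: "(nat \<Rightarrow> 'a) set" where
  "points = PiE {1..n} \<Omega>"

definition block :: "nat \<Rightarrow> nat \<Rightarrow> 'a \<Rightarrow> 'a set" where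
  "block i t v = {w \<in> \<Omega> i. \<forall>s<t. bit_of i s w = bit_of i s v}"

text \<open>The points of this cube agree with \<open>x\<close> in everything read before bit
  \<open>t\<close> of coordinate \<open>i\<close>.\<close>

definition cell :: "nat \<Rightarrow> nat \<Rightarrow> (nat \<Rightarrow> 'a) \<Rightarrow> nat \<Rightarrow> 'a set" where
  "cell i t x = (\<lambda>j. if j < i then {x j} else if j = i then block i t (x i) else \<Omega> j)"

text \<open>Dropping the conditions on earlier coordinates leaves the law of coordinate
  \<open>i\<close> unchanged under the product of the marginals, and that law can be sampled from
  \<open>\<mu>\<close> itself.\<close>

definition slab :: "nat \<Rightarrow> nat \<Rightarrow> (nat \<Rightarrow> 'a) \<Rightarrow> nat \<Rightarrow> 'a set" where
  "slab i t x = (\<lambda>j. if j = i then block i t (x i) else \<Omega> j)"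

definition steps :: "(nat \<times> nat) set" where
  "steps = (SIGMA i:{1..n}. {..<d i})"

definition bit_prob :: "(nat \<Rightarrow> 'a) pmf \<Rightarrow> (nat \<Rightarrow> 'a set) \<Rightarrow> nat \<Rightarrow> nat \<Rightarrow> real" where
  "bit_prob \<nu> A i t
    = measure_pmf.prob \<nu> (PiE {1..n} A \<inter> {z. bit_of i t (z i)}) / measure_pmf.prob \<nu> (PiE {1..n} A)"

definition gap_at :: "(nat \<Rightarrow> 'a) pmf \<Rightarrow> nat \<Rightarrow> nat \<Rightarrow> (nat \<Rightarrow> 'a) \<Rightarrow> real" where
  "gap_at \<mu> i t x = sign_gap (bit_prob \<mu> (cell i t x) i t) (bit_prob \<mu> (slab i t x) i t)"

lemma finite_points: "finite points"
  unfolding points_def by (intro finite_PiE finite_alphabet) auto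

lemma finite_steps: "finite steps"
  unfolding steps_def by auto

lemma points_mem: "x \<in> points \<Longrightarrow> i \<in> {1..n} \<Longrightarrow> x i \<in> \<Omega> i"
  unfolding points_def by auto

lemma bit_prob_bounds: "0 \<le> bit_prob \<nu> A i t" "bit_prob \<nu> A i t \<le> 1"
  unfolding bit_prob_def
  by (auto simp: divide_le_eq_1 zero_less_measure_iff intro!: measure_pmf.finite_measure_mono)

text \<open>The guard on \<open>i\<close> admits \<open>i = Suc n\<close>, where all coordinates are
  fixed and the refinement ends.\<close>

lemma PiE_cell:
  assumes x: "x \<in> points"
  shows "PiE {1..n} (cell i t x) = {z \<in> points. (\<forall>j\<in>{1..n}. j < i \<longrightarrow> z j = x j) \<and>
    (i \<in> {1..n} \<longrightarrow> (\<forall>s<t. bit_of i s (z i) = bit_of i s (x i)))}"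
proof -
  have "(\<forall>j\<in>{1..n}. z j \<in> cell i t x j) \<longleftrightarrow> (\<forall>j\<in>{1..n}. z j \<in> \<Omega> j) \<and>
      (\<forall>j\<in>{1..n}. j < i \<longrightarrow> z j = x j) \<and> (i \<in> {1..n} \<longrightarrow> (\<forall>s<t. bit_of i s (z i) = bit_of i s (x i)))"
    for z
    using points_mem[OF x] unfolding cell_def block_def
    by (auto simp del: One_nat_def split: if_splits)
  then show ?thesis unfolding points_def PiE_iff set_eq_iff mem_Collect_eq by blast
qed

lemma PiE_slab:
  assumes i: "i \<in> {1..n}"
  shows "PiE {1..n} (slab i t x) = {z \<in> points. z i \<in> block i t (x i)}"
proof -
  have "(\<forall>j\<in>{1..n}. z j \<in> slab i t x j) \<longleftrightarrow> (\<forall>j\<in>{1..n}. z j \<in> \<Omega> j) \<and> z i \<in> block i t (x i)" for z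
    using i unfolding slab_def block_def by (auto simp del: One_nat_def split: if_splits)
  then show ?thesis unfolding points_def PiE_iff set_eq_iff mem_Collect_eq by blast
qed

lemma mem_cell: "x \<in> points \<Longrightarrow> x \<in> PiE {1..n} (cell i t x)"
  unfolding PiE_cell by simp

lemma mem_slab: "x \<in> points \<Longrightarrow> i \<in> {1..n} \<Longrightarrow> x \<in> PiE {1..n} (slab i t x)"
  unfolding PiE_slab by (simp add: block_def points_mem)

text \<open>Under the product of the marginals the other coordinates contribute a common factor
  \<open>K\<close> to numerator and denominator. It is positive because \<open>x\<close> lies in the
  support, and cancels.\<close>

lemma bit_prob_marginal_product:
  assumes \<mu>: "set_pmf \<mu> \<subseteq> points" and x: "x \<in> set_pmf \<mu>" and i: "i \<in> {1..n}"
  shows "bit_prob (marginal_product n \<mu>) (cell i t x) i t = bit_prob \<mu> (slab i t x) i t"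
proof -
  define m where "m = (\<lambda>i. map_pmf (\<lambda>x. x i) \<mu>)"
  define F where "F = (\<lambda>S j. if j < i then {x j} else if j = i then S else \<Omega> j)"
  \<comment> \<open>Away from coordinate \<open>i\<close> the sets \<open>F S j\<close> are the same
    for all \<open>S\<close>; the empty set is a dummy argument.\<close>
  define K where "K = (\<Prod>j\<in>{1..n} - {i}. measure_pmf.prob (m j) (F {} j))"
  let ?B = "{z. bit_of i t (z i)}" and ?b = "block i t (x i)" and ?b' = "block i t (x i) \<inter> {v. bit_of i t v}"
  have xp: "x \<in> points" using \<mu> x by blast
  have "K > 0" unfolding K_def
  proof (intro prod_pos)
    fix j assume j: "j \<in> {1..n} - {i}"
    have "x j \<in> set_pmf (m j)" unfolding m_def using x by auto
    moreover have "x j \<in> F {} j" unfolding F_def using j points_mem[OF xp, of j] by auto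
    ultimately show "0 < measure_pmf.prob (m j) (F {} j)" by (rule measure_pmf_posI)
  qed
  have Q: "measure_pmf.prob (marginal_product n \<mu>) (PiE {1..n} (F S)) = measure_pmf.prob (m i) S * K" for S
  proof -
    have "measure_pmf.prob (marginal_product n \<mu>) (PiE {1..n} (F S)) = (\<Prod>j\<in>{1..n}. measure_pmf.prob (m j) (F S j))"
      unfolding marginal_product_def m_def PiE_dflt_undefined[symmetric] by (rule measure_Pi_pmf_PiE_dflt) simp
    also have "\<dots> = measure_pmf.prob (m i) (F S i) * (\<Prod>j\<in>{1..n} - {i}. measure_pmf.prob (m j) (F S j))"
      using i by (intro prod.remove) auto
    also have "(\<Prod>j\<in>{1..n} - {i}. measure_pmf.prob (m j) (F S j)) = K"
      unfolding K_def F_def by (intro prod.cong) auto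
    finally show ?thesis by (simp add: F_def)
  qed
  have c1: "cell i t x = F ?b" unfolding cell_def F_def ..
  have c2: "PiE {1..n} (cell i t x) \<inter> ?B = PiE {1..n} (F ?b')"
  proof -
    have "(\<forall>j\<in>{1..n}. z j \<in> F ?b j) \<and> bit_of i t (z i) \<longleftrightarrow> (\<forall>j\<in>{1..n}. z j \<in> F ?b' j)" for z
      using i unfolding F_def by (auto simp del: One_nat_def split: if_splits)
    then show ?thesis unfolding c1 PiE_iff set_eq_iff Int_iff mem_Collect_eq by blast
  qed
  have s1: "measure_pmf.prob \<mu> (PiE {1..n} (slab i t x)) = measure_pmf.prob (m i) ?b"
    unfolding m_def measure_map_pmf unfolding PiE_slab[OF i] using \<mu> by (intro prob_eq_on_support) auto
  have s2: "measure_pmf.prob \<mu> (PiE {1..n} (slab i t x) \<inter> ?B) = measure_pmf.prob (m i) ?b'"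
    unfolding m_def measure_map_pmf unfolding PiE_slab[OF i] using \<mu> by (intro prob_eq_on_support) auto
  show ?thesis
    unfolding bit_prob_def c2 s1 s2 unfolding c1 Q using \<open>K > 0\<close> by simp
qed

text \<open>The potential \<open>\<Phi>\<close>, the mean of \<open>\<phi>\<close> over the current
  cells under \<open>\<mu>\<close>, starts at \<open>\<phi> points\<close> and ends at 0 on
  singletons. Each bit lowers it by at most 15/2 times its mean gap, and 60 is this constant times
  the 8 of \<open>tv_dist_le_hellinger\<close>.\<close>

lemma tv_dist_marginal_product_le:
  assumes \<mu>: "set_pmf \<mu> \<subseteq> points"
  shows "(tv_dist \<mu> (marginal_product n \<mu>))\<^sup>2
    \<le> 60 * (\<Sum>i=1..n. \<Sum>t<d i. \<Sum>x\<in>points. pmf \<mu> x * gap_at \<mu> i t x)"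
proof -
  define P where "P = pmf \<mu>"
  define Q where "Q = pmf (marginal_product n \<mu>)"
  define R where "R = (\<lambda>i t x. PiE {1..n} (cell i t x))"
  define \<phi> where "\<phi> = (\<lambda>A. hellinger_on P Q A + (hellinger_on P Q A)\<^sup>2)"
  define \<Phi> where "\<Phi> = (\<lambda>i t. \<Sum>x\<in>points. P x * \<phi> (R i t x))"
  define G where "G = (\<lambda>i t. \<Sum>x\<in>points. P x * gap_at \<mu> i t x)"
  have suppQ: "set_pmf (marginal_product n \<mu>) \<subseteq> points"
    using \<mu> points_mem unfolding set_pmf_marginal_product points_def[symmetric]
    by (subst points_def, intro PiE_mono) blast
  \<comment> \<open>Every coordinate of a point of the support has positive marginal probability,
    hence so does the point under the product.\<close>
  have ac: "0 < Q x" if "x \<in> points" "0 < P x" for x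
  proof -
    have "x \<in> set_pmf \<mu>" using that unfolding P_def by (simp add: pmf_positive_iff)
    then have "x \<in> set_pmf (marginal_product n \<mu>)"
      using that(1) unfolding set_pmf_marginal_product points_def by (auto simp: PiE_iff)
    then show ?thesis unfolding Q_def by (rule pmf_positive)
  qed
  have step: "\<Phi> i t \<le> 15/2 * G i t + \<Phi> i (Suc t)" if i: "i \<in> {1..n}" for i t
  proof -
    let ?B = "{z. bit_of i t (z i)}"
    have "\<Phi> i t \<le> 15/2 * (\<Sum>x\<in>points. P x * sign_gap (sum P (R i t x \<inter> ?B) / sum P (R i t x))
        (sum Q (R i t x \<inter> ?B) / sum Q (R i t x))) + \<Phi> i (Suc t)"
      unfolding \<Phi>_def \<phi>_def
    proof (rule hellinger_refine[OF finite_points])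
      show "0 \<le> P x" "0 \<le> Q x" for x unfolding P_def Q_def by simp_all
      show "0 < Q x" if "x \<in> points" "0 < P x" for x using ac that .
      show "R i t x \<subseteq> points" "x \<in> R i t x" if "x \<in> points" for x
        unfolding R_def PiE_cell[OF that] using that by auto
      show "R i t z = R i t x" if x: "x \<in> points" and z: "z \<in> R i t x" for x z
      proof -
        have zp: "z \<in> points" using z unfolding R_def PiE_cell[OF x] by auto
        show ?thesis using z i unfolding R_def PiE_cell[OF x] PiE_cell[OF zp] by auto
      qed
      show "R i (Suc t) x = {z \<in> R i t x. (z \<in> ?B) = (x \<in> ?B)}" if x: "x \<in> points" for x
        using i unfolding R_def PiE_cell[OF x] by (auto simp: less_Suc_eq)
    qed
    also have "(\<Sum>x\<in>points. P x * sign_gap (sum P (R i t x \<inter> ?B) / sum P (R i t x))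
        (sum Q (R i t x \<inter> ?B) / sum Q (R i t x))) = G i t"
      unfolding G_def
    proof (intro sum.cong refl)
      fix x assume x: "x \<in> points"
      show "P x * sign_gap (sum P (R i t x \<inter> ?B) / sum P (R i t x)) (sum Q (R i t x \<inter> ?B) / sum Q (R i t x))
        = P x * gap_at \<mu> i t x"
      proof (cases "x \<in> set_pmf \<mu>")
        case True
        have "finite (R i t x)" using finite_points unfolding R_def PiE_cell[OF x] by simp
        then have "sum (pmf \<nu>) (R i t x \<inter> ?B) / sum (pmf \<nu>) (R i t x) = bit_prob \<nu> (cell i t x) i t" for \<nu>
          unfolding bit_prob_def R_def by (simp add: measure_measure_pmf_finite)
        then show ?thesis
          unfolding P_def Q_def gap_at_def bit_prob_marginal_product[OF \<mu> True i, symmetric] by simp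
      next
        case False
        then show ?thesis by (simp add: P_def set_pmf_iff)
      qed
    qed
    finally show ?thesis .
  qed
  have inner: "\<Phi> i 0 \<le> 15/2 * (\<Sum>t<k. G i t) + \<Phi> i k" if i: "i \<in> {1..n}" for i k
  proof (induction k)
    case (Suc k)
    with step[OF i, of k] show ?case unfolding sum.lessThan_Suc distrib_left by linarith
  qed simp
  \<comment> \<open>All \<open>d i\<close> bits together determine the letter, so the last cell of
    one coordinate is the first cell of the next.\<close>
  have next_coord: "\<Phi> i (d i) = \<Phi> (Suc i) 0" if i: "i \<in> {1..n}" for i
    unfolding \<Phi>_def
  proof (intro sum.cong refl)
    fix x assume x: "x \<in> points"
    have "z i = x i" if "z \<in> points" "\<forall>s<d i. bit_of i s (z i) = bit_of i s (x i)" for z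
      using bits_separate[OF i] points_mem that x i by blast
    then have "R i (d i) x = R (Suc i) 0 x"
      using i unfolding R_def PiE_cell[OF x] by (auto simp: less_Suc_eq)
    then show "P x * \<phi> (R i (d i) x) = P x * \<phi> (R (Suc i) 0 x)" by simp
  qed
  have outer: "\<Phi> 1 0 \<le> 15/2 * (\<Sum>i=1..k. \<Sum>t<d i. G i t) + \<Phi> (Suc k) 0" if "k \<le> n" for k
    using that
  proof (induction k)
    case (Suc k)
    then have i: "Suc k \<in> {1..n}" by simp
    have "\<Phi> 1 0 \<le> 15/2 * (\<Sum>i=1..k. \<Sum>t<d i. G i t) + \<Phi> (Suc k) 0" using Suc by simp
    also have "\<Phi> (Suc k) 0 \<le> 15/2 * (\<Sum>t<d (Suc k). G (Suc k) t) + \<Phi> (Suc (Suc k)) 0"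
      using inner[OF i, of "d (Suc k)"] next_coord[OF i] by simp
    finally show ?case by (simp add: algebra_simps)
  qed simp
  have R1: "R 1 0 x = points" if "x \<in> points" for x
    unfolding R_def PiE_cell[OF that] by auto
  have "\<Phi> 1 0 = (\<Sum>x\<in>points. P x) * \<phi> points"
    unfolding \<Phi>_def sum_distrib_right by (intro sum.cong refl) (simp only: R1)
  also have "(\<Sum>x\<in>points. P x) = 1" unfolding P_def using finite_points \<mu> by (rule sum_pmf_eq_1)
  finally have first: "\<Phi> 1 0 = \<phi> points" by simp
  \<comment> \<open>A singleton has distance 0 when its point has positive mass. For the other
    points the default distance is multiplied by weight 0.\<close>
  have "\<Phi> (Suc n) 0 = 0"
    unfolding \<Phi>_def
  proof (intro sum.neutral ballI)
    fix x assume x: "x \<in> points"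
    have "z = x" if "z \<in> points" "\<forall>j\<in>{1..n}. z j = x j" for z
      using that x unfolding points_def by (intro PiE_ext[of z "{1..n}" \<Omega> x]) auto
    then have "R (Suc n) 0 x = {x}"
      using x unfolding R_def PiE_cell[OF x] by auto
    moreover have "hellinger_on P Q {x} = 0" if "P x \<noteq> 0"
    proof -
      have "0 < P x" using that unfolding P_def by (simp add: pmf_pos)
      then show ?thesis using ac[OF x] by (simp add: hellinger_on_def affinity_def)
    qed
    ultimately show "P x * \<phi> (R (Suc n) 0 x) = 0" unfolding \<phi>_def by (cases "P x = 0") auto
  qed
  then have "\<phi> points \<le> 15/2 * (\<Sum>i=1..n. \<Sum>t<d i. G i t)" using outer[of n] first by simp
  moreover have "hellinger_on P Q points \<le> \<phi> points" unfolding \<phi>_def by simp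
  moreover have "(tv_dist \<mu> (marginal_product n \<mu>))\<^sup>2 \<le> 8 * hellinger_on P Q points"
    unfolding P_def Q_def by (rule tv_dist_le_hellinger[OF finite_points \<mu> suppQ])
  ultimately show ?thesis unfolding G_def P_def by linarith
qed

end

section \<open>A single trial\<close>

context bit_coding begin

text \<open>
  Query bounds range over every conceivable answer of the oracle, hence answers outside the support
  are replaced by a fixed point.
\<close>

definition decode :: "(nat \<Rightarrow> 'a) option \<Rightarrow> nat \<Rightarrow> 'a" where
  "decode r = (case r of None \<Rightarrow> x0 | Some x \<Rightarrow> if x \<in> points then x else x0)"

definition answer :: "nat \<Rightarrow> nat \<Rightarrow> (nat \<Rightarrow> 'a) option \<Rightarrow> bool" where
  "answer i t r = bit_of i t (decode r i)"

text \<open>The query \<open>\<Omega>\<close> conditions on nothing and so draws \<open>x\<close>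
  from \<open>\<mu>\<close>. The pairs of coins then compare one uniformly chosen bit with its law
  under the product of the marginals.\<close>

definition trial :: "nat \<Rightarrow> nat \<Rightarrow> real \<Rightarrow> 'a subcube_alg" where
  "trial m L T = Coin (map_pmf (\<lambda>(i, t). Query \<Omega> (\<lambda>r.
     paired_samples m (cell i t (decode r)) (slab i t (decode r)) (answer i t)
       (\<lambda>zs. Output (\<not> sign_test L T zs)))) (pmf_of_set steps))"

definition bit_pair :: "(nat \<Rightarrow> 'a) pmf \<Rightarrow> nat \<Rightarrow> nat \<Rightarrow> (nat \<Rightarrow> 'a) \<Rightarrow> (bool \<times> bool) pmf" where
  "bit_pair \<mu> i t x = pair_pmf (map_pmf (answer i t) (subcube_oracle n \<mu> (cell i t x)))
     (map_pmf (answer i t) (subcube_oracle n \<mu> (slab i t x)))"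

lemma decode_in_points: "decode r \<in> points"
  using x0 by (auto simp: decode_def points_def split: option.split)

lemma subcube_oracle_full:
  assumes "set_pmf \<mu> \<subseteq> points"
  shows "subcube_oracle n \<mu> \<Omega> = map_pmf Some \<mu>"
proof -
  have one: "measure_pmf.prob \<mu> points = 1"
    using assms by (subst measure_pmf.prob_eq_1) (auto simp: AE_measure_pmf_iff)
  have ne: "set_pmf \<mu> \<inter> points \<noteq> {}" using assms set_pmf_not_empty[of \<mu>] by blast
  have "pmf (cond_pmf \<mu> points) x = pmf \<mu> x" for x
    using assms by (auto simp: pmf_cond[OF ne] one set_pmf_iff)
  then have "cond_pmf \<mu> points = \<mu>" by (rule pmf_eqI)
  then show ?thesis unfolding subcube_oracle_def points_def[symmetric] one by simp
qed

lemma pmf_answer_subcube_oracle: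
  assumes sub: "PiE {1..n} A \<subseteq> points" and pos: "measure_pmf.prob \<mu> (PiE {1..n} A) \<noteq> 0"
  shows "pmf (map_pmf (answer i t) (subcube_oracle n \<mu> A)) True = bit_prob \<mu> A i t"
proof -
  let ?S = "PiE {1..n} A"
  have ne: "set_pmf \<mu> \<inter> ?S \<noteq> {}" using pos unfolding measure_pmf_zero_iff .
  have fin: "finite ?S" using sub finite_points finite_subset by blast
  have "map_pmf (answer i t) (subcube_oracle n \<mu> A) = map_pmf (\<lambda>x. answer i t (Some x)) (cond_pmf \<mu> ?S)"
    unfolding subcube_oracle_def using pos by (simp add: pmf.map_comp o_def)
  also have "\<dots> = map_pmf (\<lambda>x. bit_of i t (x i)) (cond_pmf \<mu> ?S)"
  proof (intro map_pmf_cong refl)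
    fix x assume "x \<in> set_pmf (cond_pmf \<mu> ?S)"
    then have "x \<in> points" using sub unfolding set_cond_pmf[OF ne] by blast
    then show "answer i t (Some x) = bit_of i t (x i)" by (simp add: answer_def decode_def)
  qed
  finally have "pmf (map_pmf (answer i t) (subcube_oracle n \<mu> A)) True
      = measure_pmf.prob (cond_pmf \<mu> ?S) ((\<lambda>x. bit_of i t (x i)) -` {True})"
    by (simp add: pmf_map)
  also have "\<dots> = bit_prob \<mu> A i t"
    unfolding bit_prob_def prob_cond_pmf[OF fin pos] by (simp add: vimage_def)
  finally show ?thesis .
qed

lemma pmf_answer_cell:
  assumes "set_pmf \<mu> \<subseteq> points" "x \<in> set_pmf \<mu>"
  shows "pmf (map_pmf (answer i t) (subcube_oracle n \<mu> (cell i t x))) True = bit_prob \<mu> (cell i t x) i t"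
proof (rule pmf_answer_subcube_oracle)
  have x: "x \<in> points" using assms by blast
  show "PiE {1..n} (cell i t x) \<subseteq> points" unfolding PiE_cell[OF x] by blast
  show "measure_pmf.prob \<mu> (PiE {1..n} (cell i t x)) \<noteq> 0"
    using measure_pmf_posI[OF assms(2) mem_cell[OF x]] by (rule less_imp_neq[THEN not_sym])
qed

lemma pmf_answer_slab:
  assumes "set_pmf \<mu> \<subseteq> points" "x \<in> set_pmf \<mu>" "i \<in> {1..n}"
  shows "pmf (map_pmf (answer i t) (subcube_oracle n \<mu> (slab i t x))) True = bit_prob \<mu> (slab i t x) i t"
proof (rule pmf_answer_subcube_oracle)
  have x: "x \<in> points" using assms by blast
  show "PiE {1..n} (slab i t x) \<subseteq> points" unfolding PiE_slab[OF assms(3)] by blast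
  show "measure_pmf.prob \<mu> (PiE {1..n} (slab i t x)) \<noteq> 0"
    using measure_pmf_posI[OF assms(2) mem_slab[OF x assms(3)]] by (rule less_imp_neq[THEN not_sym])
qed

lemma pmf_run_trial_False:
  assumes \<mu>: "set_pmf \<mu> \<subseteq> points"
  shows "pmf (run (subcube_oracle n \<mu>) (trial m L T)) False
    = measure_pmf.expectation (pair_pmf (pmf_of_set steps) \<mu>)
        (\<lambda>((i, t), x). measure_pmf.prob (replicate_pmf m (bit_pair \<mu> i t x)) {zs. sign_test L T zs})"
proof -
  let ?orc = "subcube_oracle n \<mu>"
  let ?out = "\<lambda>i t x. map_pmf (\<lambda>zs. \<not> sign_test L T zs) (replicate_pmf m (bit_pair \<mu> i t x))"
  have "run ?orc (trial m L T) = bind_pmf (pmf_of_set steps) (\<lambda>(i, t). bind_pmf (?orc \<Omega>) (\<lambda>r. ?out i t (decode r)))"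
    unfolding trial_def
    by (simp add: join_eq_bind_pmf bind_map_pmf pmf.map_comp o_def case_prod_unfold
        run_paired_samples bit_pair_def map_pmf_def[of "\<lambda>zs. \<not> sign_test L T zs"])
  also have "\<dots> = bind_pmf (pmf_of_set steps) (\<lambda>(i, t). bind_pmf \<mu> (\<lambda>x. ?out i t x))"
  proof (intro bind_pmf_cong refl, clarify)
    fix i t
    show "bind_pmf (?orc \<Omega>) (\<lambda>r. ?out i t (decode r)) = bind_pmf \<mu> (\<lambda>x. ?out i t x)"
      unfolding subcube_oracle_full[OF \<mu>] bind_map_pmf
      using \<mu> by (intro bind_pmf_cong refl) (auto simp: decode_def)
  qed
  also have "\<dots> = bind_pmf (pair_pmf (pmf_of_set steps) \<mu>) (\<lambda>((i, t), x). ?out i t x)"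
    by (simp add: pair_pmf_def bind_assoc_pmf bind_return_pmf case_prod_unfold)
  finally have *: "run ?orc (trial m L T) = bind_pmf (pair_pmf (pmf_of_set steps) \<mu>) (\<lambda>((i, t), x). ?out i t x)" .
  show ?thesis unfolding * pmf_bind
    by (intro Bochner_Integration.integral_cong refl) (auto simp: pmf_map vimage_def)
qed

context
  fixes \<mu> :: "(nat \<Rightarrow> 'a) pmf"
  assumes supp: "set_pmf \<mu> \<subseteq> points" and steps: "steps \<noteq> {}"
begin

lemma integrable_trial:
  "integrable (measure_pmf (pair_pmf (pmf_of_set steps) \<mu>)) (f :: _ \<Rightarrow> real)"
  using steps finite_steps finite_subset[OF supp finite_points]
  by (intro integrable_measure_pmf_finite) simp

lemma in_trial_support:
  "((i, t), x) \<in> set_pmf (pair_pmf (pmf_of_set steps) \<mu>) \<Longrightarrow> i \<in> {1..n} \<and> x \<in> set_pmf \<mu>"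
  using steps finite_steps by (simp add: set_pmf_of_set) (auto simp: steps_def)

text \<open>A product distribution equals the product of its marginals, so at every step and sample
  the two coins have the same law and only a false alarm of the sign test rejects.\<close>

lemma trial_accepts_product:
  assumes "product_distribution n \<Omega> \<mu>" "0 < T"
  shows "pmf (run (subcube_oracle n \<mu>) (trial m L T)) True \<ge> 1 - 2 * L / T"
proof -
  have "measure_pmf.prob (replicate_pmf m (bit_pair \<mu> i t x)) {zs. sign_test L T zs} \<le> 2 * L / T"
    if x: "x \<in> set_pmf \<mu>" and i: "i \<in> {1..n}" for i t x
  proof -
    let ?a = "map_pmf (answer i t) (subcube_oracle n \<mu> (cell i t x))"
    let ?b = "map_pmf (answer i t) (subcube_oracle n \<mu> (slab i t x))"
    have "pmf ?a True = pmf ?b True"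
      unfolding pmf_answer_cell[OF supp x] pmf_answer_slab[OF supp x i]
        bit_prob_marginal_product[OF supp x i, symmetric] marginal_product_eq[OF assms(1)] ..
    then have "pmf ?a c = pmf ?b c" for c by (cases c) (simp_all add: pmf_False_conv_True)
    then have "?a = ?b" by (rule pmf_eqI)
    then show ?thesis unfolding bit_pair_def using sign_test_null[OF assms(2)] by simp
  qed
  then have "pmf (run (subcube_oracle n \<mu>) (trial m L T)) False \<le> 2 * L / T"
    unfolding pmf_run_trial_False[OF supp]
    by (intro measure_pmf.integral_le_const integrable_trial)
      (auto simp: AE_measure_pmf_iff simp del: set_pair_pmf One_nat_def dest!: in_trial_support)
  then show ?thesis by (simp add: pmf_False_conv_True)
qed

text \<open>Wherever the gap reaches \<open>\<delta>\<close>, the sign test fires with probability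
  at least 1/2.\<close>

lemma trial_rejects:
  assumes \<delta>: "0 < \<delta>" and L: "4 / \<delta> \<le> real L" and T: "0 < T" and m: "T * exp (- \<delta> * m / 8) \<le> 1/2"
  shows "measure_pmf.prob (pair_pmf (pmf_of_set steps) \<mu>) {((i, t), x). \<delta> \<le> gap_at \<mu> i t x} / 2
    \<le> pmf (run (subcube_oracle n \<mu>) (trial m L T)) False"
proof -
  let ?D = "pair_pmf (pmf_of_set steps) \<mu>"
  let ?E = "{((i, t), x). \<delta> \<le> gap_at \<mu> i t x}"
  let ?f = "\<lambda>((i, t), x). measure_pmf.prob (replicate_pmf m (bit_pair \<mu> i t x)) {zs. sign_test L T zs}"
  have "indicator ?E z / 2 \<le> ?f z" if z: "z \<in> set_pmf ?D" for z
  proof (cases "z \<in> ?E")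
    case True
    obtain i t x where [simp]: "z = ((i, t), x)" by (metis prod.exhaust)
    have i: "i \<in> {1..n}" and x: "x \<in> set_pmf \<mu>" using in_trial_support z by auto
    have "\<delta> \<le> gap_at \<mu> i t x" using True by simp
    then have "1/2 \<le> measure_pmf.prob (replicate_pmf m (bit_pair \<mu> i t x)) {zs. sign_test L T zs}"
      unfolding bit_pair_def gap_at_def
      by (intro sign_test_power[OF _ \<delta> L T m]) (simp only: pmf_answer_cell[OF supp x] pmf_answer_slab[OF supp x i])
    then show ?thesis using True by simp
  qed (auto simp: case_prod_beta)
  then have "measure_pmf.expectation ?D (\<lambda>z. indicator ?E z / 2) \<le> measure_pmf.expectation ?D ?f"
    by (intro integral_mono_AE integrable_trial) (simp only: AE_measure_pmf_iff, blast)
  then show ?thesis unfolding pmf_run_trial_False[OF supp] by simp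
qed

text \<open>This links the sum bounding the distance to the mean gap seen by one trial; the uniform
  choice of a bit costs the factor \<open>card steps\<close>.\<close>

lemma expectation_gap:
  "measure_pmf.expectation (pair_pmf (pmf_of_set steps) \<mu>) (\<lambda>((i, t), x). gap_at \<mu> i t x)
    = (\<Sum>i=1..n. \<Sum>t<d i. \<Sum>x\<in>points. pmf \<mu> x * gap_at \<mu> i t x) / card steps"
proof -
  let ?g = "\<lambda>((i, t), x). gap_at \<mu> i t x"
  let ?D = "pair_pmf (pmf_of_set steps) \<mu>"
  have "measure_pmf.expectation ?D ?g = (\<Sum>z\<in>steps \<times> points. ?g z * pmf ?D z)"
    using finite_steps finite_points steps supp
    by (intro integral_measure_pmf_real) (auto simp: set_pmf_of_set)
  also have "\<dots> = (\<Sum>s\<in>steps. \<Sum>x\<in>points. ?g (s, x) * pmf ?D (s, x))"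
    by (simp add: sum.cartesian_product case_prod_beta)
  also have "\<dots> = (\<Sum>(i, t)\<in>steps. \<Sum>x\<in>points. pmf \<mu> x * gap_at \<mu> i t x / card steps)"
    using finite_steps steps
    by (intro sum.cong refl) (auto simp: pmf_pair pmf_of_set indicator_def field_simps)
  also have "\<dots> = (\<Sum>i=1..n. \<Sum>t<d i. \<Sum>x\<in>points. pmf \<mu> x * gap_at \<mu> i t x / card steps)"
    unfolding steps_def by (rule sum.Sigma[symmetric]) auto
  finally show ?thesis by (simp add: sum_divide_distrib)
qed

end

section \<open>Number and shape of the queries of a trial\<close>

lemma queries_at_most_trial: "queries_at_most (Suc (2 * m)) (trial m L T)"
proof -
  have "queries_at_most (2 * m) (paired_samples m A B f (\<lambda>zs. Output (\<not> sign_test L T zs)))"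
    for A B :: "nat \<Rightarrow> 'a set" and f :: "(nat \<Rightarrow> 'a) option \<Rightarrow> bool"
    using queries_at_most_paired_samples[of 0 "\<lambda>zs. Output (\<not> sign_test L T zs)"]
    by (simp add: queries_at_most.intros)
  then show ?thesis unfolding trial_def by (auto intro!: queries_at_most.intros)
qed

lemma all_queries_trial:
  assumes "steps \<noteq> {}" "P \<Omega>"
    and "\<And>i t x. (i, t) \<in> steps \<Longrightarrow> x \<in> points \<Longrightarrow> P (cell i t x) \<and> P (slab i t x)"
  shows "all_queries P (trial m L T)"
  unfolding trial_def using assms(2,3) set_pmf_of_set[OF assms(1) finite_steps] decode_in_points
  by (auto intro!: all_queries.intros all_queries_paired_samples)

lemma subcube_queries_trial:
  assumes "steps \<noteq> {}"
  shows "all_queries (subcube_query n \<Omega>) (trial m L T)"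
proof (rule all_queries_trial[OF assms])
  show "subcube_query n \<Omega> \<Omega>" by (simp add: subcube_query_def)
  show "subcube_query n \<Omega> (cell i t x) \<and> subcube_query n \<Omega> (slab i t x)" if "x \<in> points" for i t x
    using points_mem[OF that] by (auto simp: subcube_query_def cell_def slab_def block_def simp del: One_nat_def)
qed

text \<open>With one bit per coordinate only \<open>t = 0\<close> occurs, and a block under no bit
  conditions is the whole alphabet. Slabs are then the full cube, and cells fix exactly the
  coordinates before \<open>i\<close>.\<close>

lemma prefix_queries_trial:
  assumes ne: "steps \<noteq> {}" and d1: "\<And>i. i \<in> {1..n} \<Longrightarrow> d i = 1"
  shows "all_queries (prefix_query n \<Omega>) (trial m L T)"
proof (rule all_queries_trial[OF ne])
  \<comment> \<open>The full cube is a prefix query with index 1, which exists because there is a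
    bit to test.\<close>
  have "1 \<in> {1..n}" using ne by (auto simp: steps_def)
  then show full: "prefix_query n \<Omega> \<Omega>"
    unfolding prefix_query_def subcube_query_def by (auto intro!: bexI[of _ 1])
  fix i t x assume it: "(i, t) \<in> steps" and x: "x \<in> points"
  then have i: "i \<in> {1..n}" and t: "t = 0" using d1 by (auto simp: steps_def)
  have "slab i t x = \<Omega>" by (simp add: fun_eq_iff slab_def block_def t)
  moreover have "prefix_query n \<Omega> (cell i t x)"
    unfolding prefix_query_def subcube_query_def
  proof (intro conjI bexI[OF _ i] ballI)
    show "cell i t x j \<subseteq> \<Omega> j" if "j \<in> {1..n}" for j
      using points_mem[OF x that] by (auto simp: cell_def block_def)
  qed (auto simp: cell_def)
  ultimately show "prefix_query n \<Omega> (cell i t x) \<and> prefix_query n \<Omega> (slab i t x)" using full by simp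
qed

end

section \<open>The tester\<close>

lemma prod_list_concat_replicate:
  fixes f :: "'b \<Rightarrow> real"
  shows "(\<Prod>x\<leftarrow>concat (map (\<lambda>j. replicate (R j) (t j)) [0..<k]). f x) = (\<Prod>j<k. f (t j) ^ R j)"
  by (induction k) simp_all

lemma sum_list_concat_replicate:
  fixes f :: "'b \<Rightarrow> nat"
  shows "(\<Sum>x\<leftarrow>concat (map (\<lambda>j. replicate (R j) (t j)) [0..<k]). f x) = (\<Sum>j<k. R j * f (t j))"
  by (induction k) (simp_all add: sum_list_replicate)

context bit_coding begin

text \<open>
  Scale \<open>j\<close> looks for gaps of size \<open>2 ^ -j\<close>. Fewer trials are needed the larger \<open>j\<close> is, and each trial needs
  proportionally more samples. The rejection threshold \<open>2 ^ (8 + 4J)\<close> absorbs a union bound over all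
  trials and all stakes.
\<close>

definition tester :: "nat \<Rightarrow> 'a subcube_alg" where
  "tester J = accept_all (concat (map (\<lambda>j. replicate (8 * (J + 1) * 2 ^ (J - j))
     (trial (8 * 2 ^ j * (9 + 4 * J)) (4 * 2 ^ J) (2 ^ (8 + 4 * J)))) [0..<Suc J]))"

lemma pmf_run_tester:
  "pmf (run orc (tester J)) True = (\<Prod>j<Suc J.
     pmf (run orc (trial (8 * 2 ^ j * (9 + 4 * J)) (4 * 2 ^ J) (2 ^ (8 + 4 * J)))) True ^ (8 * (J + 1) * 2 ^ (J - j)))"
  unfolding tester_def pmf_run_accept_all prod_list_concat_replicate ..

lemma all_queries_tester:
  "(\<And>m L T. all_queries P (trial m L T)) \<Longrightarrow> all_queries P (tester J)"
  unfolding tester_def by (intro all_queries_accept_all) auto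

text \<open>The factor \<open>2 ^ (J - j)\<close> in the number of trials and \<open>2 ^ j\<close>
  in their length multiply to \<open>2 ^ J\<close> on each of the \<open>J + 1\<close>
  scales.\<close>

lemma queries_at_most_tester: "queries_at_most (1224 * (J + 1) ^ 3 * 2 ^ J) (tester J)"
proof -
  let ?trial = "\<lambda>j. trial (8 * 2 ^ j * (9 + 4 * J)) (4 * 2 ^ J) (2 ^ (8 + 4 * J))"
  let ?f = "\<lambda>j. Suc (2 * (8 * 2 ^ j * (9 + 4 * J)))"
  let ?Ts = "concat (map (\<lambda>j. replicate (8 * (J + 1) * 2 ^ (J - j)) (?f j, ?trial j)) [0..<Suc J])"
  have 1: "queries_at_most (\<Sum>z\<leftarrow>?Ts. fst z) (accept_all (map snd ?Ts))"
  proof (rule queries_at_most_accept_all)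
    fix q T assume "(q, T) \<in> set ?Ts"
    then obtain j where "q = ?f j" "T = ?trial j" by auto
    then show "queries_at_most q T" by (simp only: queries_at_most_trial)
  qed
  have "map snd ?Ts = concat (map (\<lambda>j. replicate (8 * (J + 1) * 2 ^ (J - j)) (?trial j)) [0..<Suc J])"
    by (simp add: map_concat o_def)
  then have 2: "accept_all (map snd ?Ts) = tester J" unfolding tester_def by simp
  have 3: "(\<Sum>z\<leftarrow>?Ts. fst z) \<le> 1224 * (J + 1) ^ 3 * 2 ^ J"
  proof -
    have "(\<Sum>z\<leftarrow>?Ts. fst z) = (\<Sum>j<Suc J. 8 * (J + 1) * 2 ^ (J - j) * ?f j)"
      unfolding sum_list_concat_replicate by simp
    also have "\<dots> \<le> (\<Sum>j<Suc J. 1224 * (J + 1) ^ 2 * 2 ^ J)"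
    proof (rule sum_mono)
      fix j assume "j \<in> {..<Suc J}"
      then have pw: "(2::nat) ^ (J - j) * 2 ^ j = 2 ^ J" by (simp add: power_add[symmetric])
      \<comment> \<open>The extra query for \<open>x\<close> turns 16 into 17, and
        \<open>9 + 4 * J \<le> 9 * (J + 1)\<close>; with the 8 of the number of trials this gives
        \<open>1224 = 8 * 17 * 9\<close>.\<close>
      have "?f j \<le> 2 ^ j * (9 + 4 * J) + 16 * (2 ^ j * (9 + 4 * J))" by simp
      also have "\<dots> = 17 * 2 ^ j * (9 + 4 * J)" by simp
      also have "\<dots> \<le> 17 * 2 ^ j * (9 * (J + 1))" by (intro mult_le_mono) auto
      finally have "8 * (J + 1) * 2 ^ (J - j) * ?f j \<le> 8 * (J + 1) * 2 ^ (J - j) * (17 * 2 ^ j * (9 * (J + 1)))"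
        by (rule mult_le_mono2)
      also have "\<dots> = 1224 * (J + 1) ^ 2 * (2 ^ (J - j) * 2 ^ j)" by (simp add: power2_eq_square algebra_simps)
      finally show "8 * (J + 1) * 2 ^ (J - j) * ?f j \<le> 1224 * (J + 1) ^ 2 * 2 ^ J" unfolding pw .
    qed
    also have "\<dots> = 1224 * (J + 1) ^ 3 * 2 ^ J" by (simp add: power3_eq_cube power2_eq_square algebra_simps)
    finally show ?thesis .
  qed
  show ?thesis using queries_at_most_mono[OF 1 3] unfolding 2 .
qed

lemma tester_accepts_product:
  assumes supp: "set_pmf \<mu> \<subseteq> points" and ne: "steps \<noteq> {}" and prod: "product_distribution n \<Omega> \<mu>"
  shows "pmf (run (subcube_oracle n \<mu>) (tester J)) True \<ge> 2/3"
proof -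
  \<comment> \<open>\<open>\<alpha>\<close> bounds the false alarm probability of one trial, and
    \<open>N\<close> is the number of trials. The threshold makes \<open>N * \<alpha>\<close> at
    most 1/4, so Bernoulli's inequality suffices.\<close>
  define \<alpha> :: real where "\<alpha> = 2 * real (4 * 2 ^ J) / 2 ^ (8 + 4 * J)"
  define N where "N = (\<Sum>j<Suc J. 8 * (J + 1) * 2 ^ (J - j) :: nat)"
  have N: "real N \<le> 8 * 2 ^ (3 * J)"
  proof -
    have "N \<le> (\<Sum>j<Suc J. 8 * 2 ^ J * 2 ^ J)"
      unfolding N_def
    proof (intro sum_mono mult_le_mono)
      show "J + 1 \<le> 2 ^ J" by (simp add: Suc_le_eq)
      show "(2::nat) ^ (J - j) \<le> 2 ^ J" for j by simp
    qed simp
    also have "\<dots> = (J + 1) * (8 * 2 ^ J * 2 ^ J)" by simp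
    also have "\<dots> \<le> 2 ^ J * (8 * 2 ^ J * 2 ^ J)" by (intro mult_le_mono) (simp_all add: Suc_le_eq)
    also have "\<dots> = 8 * 2 ^ (3 * J)" by (simp add: power_add[symmetric] mult_ac numeral_3_eq_3)
    finally have "real N \<le> real (8 * 2 ^ (3 * J))" by (simp only: of_nat_le_iff)
    then show ?thesis by simp
  qed
  have \<alpha>: "\<alpha> = 1 / (32 * 2 ^ (3 * J))"
  proof -
    have "(2::real) ^ (8 + 4 * J) = 2 ^ 8 * (2 ^ J * 2 ^ (3 * J))"
      by (simp only: power_add[symmetric]) simp
    then show ?thesis unfolding \<alpha>_def by simp
  qed
  have "(1::real) \<le> 2 ^ (3 * J)" by simp
  then have "(1::real) \<le> 32 * 2 ^ (3 * J)" by linarith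
  then have \<alpha>1: "\<alpha> \<le> 1" "0 \<le> \<alpha>" unfolding \<alpha> by (simp_all add: divide_le_eq_1)
  have "2/3 \<le> 1 + real N * (- \<alpha>)"
  proof -
    have "real N * \<alpha> \<le> 8 * 2 ^ (3 * J) * \<alpha>" using N \<alpha>1 by (intro mult_right_mono)
    also have "\<dots> = 1/4" unfolding \<alpha> by simp
    finally show ?thesis by simp
  qed
  also have "\<dots> \<le> (1 + (- \<alpha>)) ^ N" using \<alpha>1 by (intro Bernoulli_inequality) simp
  also have "\<dots> = (\<Prod>j<Suc J. (1 - \<alpha>) ^ (8 * (J + 1) * 2 ^ (J - j)))"
    unfolding N_def by (simp only: power_sum) simp
  also have "\<dots> \<le> pmf (run (subcube_oracle n \<mu>) (tester J)) True"
    unfolding pmf_run_tester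
  proof (intro prod_mono conjI power_mono zero_le_power)
    fix j
    show "1 - \<alpha> \<le> pmf (run (subcube_oracle n \<mu>) (trial (8 * 2 ^ j * (9 + 4 * J)) (4 * 2 ^ J) (2 ^ (8 + 4 * J)))) True"
      unfolding \<alpha>_def by (rule trial_accepts_product[OF supp ne prod]) simp
  qed (use \<alpha>1 in auto)
  finally show ?thesis .
qed

text \<open>The mean gap is at least \<open>\<theta>\<close>, so some scale \<open>j\<close> carries
  its share. Its trials each reject with probability at least
  \<open>\<theta> * 2 ^ j / (8 * (J + 1))\<close>, and there are enough of them for all to accept
  with probability at most \<open>exp (- (\<theta> * 2 ^ J))\<close>.\<close>

lemma tester_rejects:
  assumes supp: "set_pmf \<mu> \<subseteq> points" and ne: "steps \<noteq> {}"
    and tv: "\<epsilon> < tv_dist \<mu> (marginal_product n \<mu>)" and \<epsilon>: "0 < \<epsilon>"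
    and J: "120 * card steps / \<epsilon>\<^sup>2 \<le> 2 ^ J"
  shows "pmf (run (subcube_oracle n \<mu>) (tester J)) False \<ge> 2/3"
proof -
  let ?D = "pair_pmf (pmf_of_set steps) \<mu>"
  define \<theta> where "\<theta> = \<epsilon>\<^sup>2 / (60 * card steps)"
  have N: "0 < card steps" using ne finite_steps by (simp add: card_gt_0_iff)
  have \<theta>0: "0 < \<theta>" unfolding \<theta>_def using \<epsilon> N by simp
  have \<theta>J: "1 / 2 ^ J \<le> \<theta> / 2"
    using J \<epsilon> N unfolding \<theta>_def by (simp add: field_simps)
  have "\<epsilon>\<^sup>2 \<le> (tv_dist \<mu> (marginal_product n \<mu>))\<^sup>2" using tv \<epsilon> by (intro power_mono) auto
  also have "\<dots> \<le> 60 * (\<Sum>i=1..n. \<Sum>t<d i. \<Sum>x\<in>points. pmf \<mu> x * gap_at \<mu> i t x)"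
    by (rule tv_dist_marginal_product_le[OF supp])
  finally have "\<theta> \<le> measure_pmf.expectation ?D (\<lambda>((i, t), x). gap_at \<mu> i t x)"
    unfolding expectation_gap[OF supp ne] \<theta>_def using N by (simp add: field_simps)
  moreover have "finite (set_pmf ?D)"
    using ne finite_steps finite_subset[OF supp finite_points] by simp
  ultimately have "\<exists>j\<le>J. \<theta> * 2 ^ j / (4 * (J + 1))
      \<le> measure_pmf.prob ?D {z. 1 / 2 ^ j \<le> (\<lambda>((i, t), x). gap_at \<mu> i t x) z}"
    using \<theta>0 \<theta>J
    by (intro dyadic_bucket) (auto simp: gap_at_def sign_gap_bounds bit_prob_bounds)
  then obtain j where jJ: "j \<le> J" and j: "\<theta> * 2 ^ j / (4 * (J + 1)) \<le> measure_pmf.prob ?D {((i, t), x). 1 / 2 ^ j \<le> gap_at \<mu> i t x}"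
    by (auto simp: case_prod_unfold)
  let ?a = "\<lambda>j. pmf (run (subcube_oracle n \<mu>) (trial (8 * 2 ^ j * (9 + 4 * J)) (4 * 2 ^ J) (2 ^ (8 + 4 * J)))) True"
  let ?R = "\<lambda>j. 8 * (J + 1) * 2 ^ (J - j) :: nat"
  have "\<theta> * 2 ^ j / (8 * (J + 1)) = \<theta> * 2 ^ j / (4 * (J + 1)) / 2" by simp
  also have "\<dots> \<le> measure_pmf.prob ?D {((i, t), x). 1 / 2 ^ j \<le> gap_at \<mu> i t x} / 2"
    using j by (rule divide_right_mono) simp
  also have "\<dots> \<le> 1 - ?a j"
    unfolding pmf_False_conv_True[symmetric]
  proof (rule trial_rejects[OF supp ne])
    show "4 / (1 / 2 ^ j) \<le> real (4 * 2 ^ J)" using jJ by simp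
    \<comment> \<open>The number of pairs makes the exponent of the power bound
      \<open>- (9 + 4 * J)\<close>, one more than the threshold's binary exponent, which supplies
      the required factor 1/2.\<close>
    have "(2::real) ^ (8 + 4 * J) * 2 = 2 ^ (9 + 4 * J)" by (simp add: power_add)
    also have "\<dots> \<le> exp 1 ^ (9 + 4 * J)" using exp_ge_add_one_self[of 1] by (intro power_mono) auto
    also have "\<dots> = exp (9 + 4 * J)" by (simp add: exp_of_nat_mult[symmetric])
    finally have "2 ^ (8 + 4 * J) * exp (- (9 + 4 * real J)) \<le> 1/2"
      unfolding exp_minus by (simp add: field_simps)
    moreover have "- (1 / 2 ^ j) * real (8 * 2 ^ j * (9 + 4 * J)) / 8 = - (9 + 4 * real J)" by simp
    ultimately show "2 ^ (8 + 4 * J) * exp (- (1 / 2 ^ j) * real (8 * 2 ^ j * (9 + 4 * J)) / 8) \<le> 1/2"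
      by (simp only:)
  qed simp_all
  finally have "?a j \<le> 1 + - (\<theta> * 2 ^ j / (8 * (J + 1)))" by simp
  also have "\<dots> \<le> exp (- (\<theta> * 2 ^ j / (8 * (J + 1))))" by (rule exp_ge_add_one_self)
  finally have "?a j ^ ?R j \<le> exp (- (\<theta> * 2 ^ j / (8 * (J + 1)))) ^ ?R j"
    by (intro power_mono) auto
  also have "\<dots> = exp (- (\<theta> * 2 ^ J))"
  proof -
    have "(2::real) ^ J = 2 ^ (J - j) * 2 ^ j" using jJ by (simp add: power_add[symmetric])
    then have "real (?R j) * (- (\<theta> * 2 ^ j / (8 * (J + 1)))) = - (\<theta> * 2 ^ J)" by (simp add: field_simps)
    then show ?thesis by (simp only: exp_of_nat_mult[symmetric])
  qed
  \<comment> \<open>The assumption on \<open>J\<close> says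
    \<open>2 \<le> \<theta> * 2 ^ J\<close>.\<close>
  also have "\<dots> \<le> exp (- 2)" using \<theta>J by (simp add: field_simps)
  also have "\<dots> \<le> 1/3" using exp_ge_add_one_self[of 2] by (simp add: exp_minus field_simps)
  finally have aj: "?a j ^ ?R j \<le> 1/3" .
  have "pmf (run (subcube_oracle n \<mu>) (tester J)) True = ?a j ^ ?R j * (\<Prod>j\<in>{..<Suc J} - {j}. ?a j ^ ?R j)"
    unfolding pmf_run_tester using jJ by (intro prod.remove) auto
  also have "\<dots> \<le> ?a j ^ ?R j * 1"
    by (intro mult_left_mono prod_le_1) (auto simp: pmf_le_1 power_le_one)
  finally show ?thesis using aj by (simp add: pmf_False_conv_True)
qed

end

section \<open>Binary codes and the number of scales\<close>

lemma ex_bit_coding: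
  assumes "finite A"
  shows "\<exists>b :: nat \<Rightarrow> 'a \<Rightarrow> bool. \<forall>v\<in>A. \<forall>w\<in>A. (\<forall>s<nat \<lceil>log 2 (card A)\<rceil>. b s v = b s w) \<longrightarrow> v = w"
proof (cases "A = {}")
  case False
  define k where "k = nat \<lceil>log 2 (card A)\<rceil>"
  \<comment> \<open>The code of a letter consists of the binary digits of its number in an
    enumeration of \<open>A\<close>.\<close>
  obtain e :: "'a \<Rightarrow> nat" where e: "bij_betw e A {0..<card A}"
    using ex_bij_betw_finite_nat[OF assms] by blast
  have c0: "0 < card A" using False assms by (simp add: card_gt_0_iff)
  have "real (card A) = 2 powr (log 2 (card A))" using c0 by simp
  also have "\<dots> \<le> 2 powr (real k)" unfolding k_def by (intro powr_mono) (auto intro: real_nat_ceiling_ge)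
  finally have "real (card A) \<le> real (2 ^ k)" by (simp add: powr_realpow)
  then have c: "card A \<le> 2 ^ k" by (simp only: of_nat_le_iff)
  have "v = w" if v: "v \<in> A" and w: "w \<in> A" and eq: "\<forall>s<k. bit (e v) s = bit (e w) s" for v w
  proof -
    have small: "e u < 2 ^ k" if "u \<in> A" for u
      using bij_betw_apply[OF e that] c by simp
    have "take_bit k (e v) = take_bit k (e w)"
      using eq by (intro bit_eqI) (auto simp: bit_take_bit_iff)
    then have "e v = e w" using small v w by (simp add: take_bit_nat_eq_self)
    then show ?thesis using e v w by (auto simp: bij_betw_def inj_on_def)
  qed
  then show ?thesis unfolding k_def by (intro exI[of _ "\<lambda>s v. bit (e v) s"]) blast
qed auto

text \<open>Rounding up to a power of two at most doubles \<open>Y\<close>, which gives the 480; the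
  cube of \<open>J + 1\<close> becomes the logarithmic factor.\<close>

lemma dyadic_parameter_bounds:
  fixes X Y :: real
  assumes "1 \<le> Y" "Y \<le> 240 * X"
  defines "J \<equiv> nat \<lceil>log 2 Y\<rceil>"
  shows "Y \<le> 2 ^ J"
    and "real (1224 * (J + 1) ^ 3 * 2 ^ J) \<le> (1224 * 11 ^ 3 * 480) * X * log 2 (2 + X) ^ 3"
proof -
  have J: "log 2 Y \<le> real J" "real J \<le> log 2 Y + 1"
    using assms(1) zero_le_log_cancel_iff[of 2 Y] unfolding J_def by linarith+
  have pJ: "2 powr real J = 2 ^ J" by (simp add: powr_realpow)
  have "Y = 2 powr log 2 Y" using assms by simp
  also have "\<dots> \<le> 2 powr real J" using J by simp
  finally show "Y \<le> 2 ^ J" unfolding pJ .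
  have "2 powr real J \<le> 2 powr (log 2 Y + 1)" using J by simp
  also have "\<dots> = 2 * Y" using assms by (simp add: powr_add)
  finally have 1: "2 ^ J \<le> 480 * X" using assms unfolding pJ by linarith
  have X: "0 < X" using assms by simp
  let ?l = "log 2 (2 + X)"
  have "log 2 2 \<le> ?l" using X by (subst log_le_cancel_iff) auto
  then have l: "1 \<le> ?l" by simp
  have "real J + 1 \<le> log 2 Y + 2" using J by simp
  also have "\<dots> \<le> log 2 (240 * X) + 2" using assms by simp
  \<comment> \<open>A power of two has an exact logarithm: the additive terms become
    \<open>8 + 2 = 10\<close>.\<close>
  also have "\<dots> \<le> log 2 (256 * X) + 2" using X by simp
  also have "\<dots> = 10 + log 2 X"
  proof -
    have "log 2 (2 ^ 8 :: real) = 8" by (subst log_nat_power) simp_all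
    then show ?thesis using X by (simp add: log_mult)
  qed
  also have "\<dots> \<le> 10 * ?l + ?l" using l X by (intro add_mono) auto
  finally have "real (J + 1) \<le> 11 * ?l" by simp
  then have "real (J + 1) ^ 3 \<le> (11 * ?l) ^ 3" by (intro power_mono) auto
  then have "real (J + 1) ^ 3 * 2 ^ J \<le> (11 * ?l) ^ 3 * (480 * X)"
    using 1 l by (intro mult_mono) auto
  then show "real (1224 * (J + 1) ^ 3 * 2 ^ J) \<le> (1224 * 11 ^ 3 * 480) * X * ?l ^ 3"
    by (simp add: power_mult_distrib algebra_simps)
qed

text \<open>Cardinality 0 is covered by the convention \<open>ln 0 = 0\<close>.\<close>

lemma log_card_nonneg: "0 \<le> log 2 (real (card A))"
  by (cases "card A = 0") (auto simp: log_def)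

theorem theorem5:
  "\<exists>(C::real) (k::nat). \<forall>(n::nat) (\<Omega> :: nat \<Rightarrow> 'a set) (\<epsilon>::real).
     (\<forall>i\<in>{1..n}. finite (\<Omega> i)) \<and> 0 < \<epsilon> \<and> \<epsilon> < 1 \<longrightarrow>
     (\<exists>(T :: 'a subcube_alg) (q::nat).
        queries_at_most q T \<and>
        (let X = (\<Sum>i=1..n. log 2 (real (card (\<Omega> i)))) / \<epsilon>\<^sup>2
         in real q \<le> C * X * (log 2 (2 + X)) ^ k) \<and>
        all_queries (subcube_query n \<Omega>) T \<and>
        ((\<forall>i\<in>{1..n}. card (\<Omega> i) = 2) \<longrightarrow> all_queries (prefix_query n \<Omega>) T) \<and>
        (\<forall>\<mu>. distribution_over n \<Omega> \<mu> \<longrightarrow>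
           (product_distribution n \<Omega> \<mu> \<longrightarrow> pmf (run (subcube_oracle n \<mu>) T) True \<ge> 2 / 3) \<and>
           (far_from_product n \<Omega> \<epsilon> \<mu> \<longrightarrow> pmf (run (subcube_oracle n \<mu>) T) False \<ge> 2 / 3)))"
proof (rule exI[of _ "1224 * 11 ^ 3 * 480"], rule exI[of _ 3], intro allI impI, elim conjE)
  fix n :: nat and \<Omega> :: "nat \<Rightarrow> 'a set" and \<epsilon> :: real
  assume fin: "\<forall>i\<in>{1..n}. finite (\<Omega> i)" and \<epsilon>: "0 < \<epsilon>" "\<epsilon> < 1"
  define X where "X = (\<Sum>i=1..n. log 2 (real (card (\<Omega> i)))) / \<epsilon>\<^sup>2"
  have X0: "0 \<le> X" unfolding X_def by (intro divide_nonneg_nonneg sum_nonneg log_card_nonneg) simp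
  let ?good = "\<lambda>(T :: 'a subcube_alg) (q::nat). queries_at_most q T \<and>
        real q \<le> (1224 * 11 ^ 3 * 480) * X * (log 2 (2 + X)) ^ 3 \<and>
        all_queries (subcube_query n \<Omega>) T \<and>
        ((\<forall>i\<in>{1..n}. card (\<Omega> i) = 2) \<longrightarrow> all_queries (prefix_query n \<Omega>) T) \<and>
        (\<forall>\<mu>. distribution_over n \<Omega> \<mu> \<longrightarrow>
           (product_distribution n \<Omega> \<mu> \<longrightarrow> pmf (run (subcube_oracle n \<mu>) T) True \<ge> 2 / 3) \<and>
           (far_from_product n \<Omega> \<epsilon> \<mu> \<longrightarrow> pmf (run (subcube_oracle n \<mu>) T) False \<ge> 2 / 3))"
  \<comment> \<open>If nothing is far, accepting without queries is correct. This handles degenerate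
    spaces, where \<open>X\<close>, and with it the query budget, may be 0.\<close>
  have trivial: "?good (Output True) 0" if "\<And>\<mu>. distribution_over n \<Omega> \<mu> \<Longrightarrow> \<not> far_from_product n \<Omega> \<epsilon> \<mu>"
    using that X0 by (auto intro!: queries_at_most.intros all_queries.intros mult_nonneg_nonneg zero_le_power)
  have "\<exists>T q. ?good T q"
  proof (cases "PiE {1..n} \<Omega> = {}")
    case True
    then have "\<not> distribution_over n \<Omega> \<mu>" for \<mu>
      using set_pmf_not_empty[of \<mu>] unfolding distribution_over_def by simp
    then show ?thesis using trivial by blast
  next
    case False
    then obtain x0 where x0: "x0 \<in> PiE {1..n} \<Omega>" by blast
    define d where "d i = nat \<lceil>log 2 (real (card (\<Omega> i)))\<rceil>" for i
    have "\<forall>i\<in>{1..n}. \<exists>b :: nat \<Rightarrow> 'a \<Rightarrow> bool. \<forall>v\<in>\<Omega> i. \<forall>w\<in>\<Omega> i. (\<forall>s<d i. b s v = b s w) \<longrightarrow> v = w"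
      unfolding d_def using fin by (intro ballI ex_bit_coding) auto
    from bchoice[OF this] obtain b :: "nat \<Rightarrow> nat \<Rightarrow> 'a \<Rightarrow> bool" where b: "\<forall>i\<in>{1..n}. \<forall>v\<in>\<Omega> i. \<forall>w\<in>\<Omega> i. (\<forall>s<d i. b i s v = b i s w) \<longrightarrow> v = w"
      by (elim exE)
    interpret bit_coding n \<Omega> d b x0
    proof
      show "finite (\<Omega> i)" if "i \<in> {1..n}" for i using fin that by blast
      show "v = w" if "i \<in> {1..n}" "v \<in> \<Omega> i" "w \<in> \<Omega> i" "\<forall>s<d i. b i s v = b i s w" for i v w
        using b that by (simp del: One_nat_def)
    qed (fact x0)
    have supp: "set_pmf \<mu> \<subseteq> points" if "distribution_over n \<Omega> \<mu>" for \<mu>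
      using that unfolding distribution_over_def points_def .
    have far: "\<epsilon> < tv_dist \<mu> (marginal_product n \<mu>)" if "distribution_over n \<Omega> \<mu>" "far_from_product n \<Omega> \<epsilon> \<mu>" for \<mu>
      using that product_distribution_marginal_product unfolding far_from_product_def by blast
    show ?thesis
    proof (cases "steps = {}")
      case True
      have d0: "d i = 0" if i: "i \<in> {1..n}" for i
      proof (rule ccontr)
        assume "d i \<noteq> 0"
        then have "(i, 0) \<in> steps" using i unfolding steps_def by simp
        then show False using True by simp
      qed
      have "\<not> far_from_product n \<Omega> \<epsilon> \<mu>" if \<mu>: "distribution_over n \<Omega> \<mu>" for \<mu>
      proof
        assume "far_from_product n \<Omega> \<epsilon> \<mu>"
        then have "\<epsilon> < tv_dist \<mu> (marginal_product n \<mu>)" using far \<mu> by blast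
        \<comment> \<open>Without bits to compare, the bound on the distance is an empty
          sum.\<close>
        moreover have "(tv_dist \<mu> (marginal_product n \<mu>))\<^sup>2 \<le> 0"
          using tv_dist_marginal_product_le[OF supp[OF \<mu>]] d0 by simp
        ultimately show False using \<epsilon> by simp
      qed
      then show ?thesis using trivial by blast
    next
      case ne: False
      define Y where "Y = 120 * card steps / \<epsilon>\<^sup>2"
      define J where "J = nat \<lceil>log 2 Y\<rceil>"
      have "real (card steps) = (\<Sum>i=1..n. real (d i))"
        unfolding steps_def by (simp add: card_SigmaI)
      \<comment> \<open>Rounding up at most doubles a logarithm that is at least 1; an alphabet with
        fewer than two letters has no bits. This doubling turns the 120 of \<open>Y\<close> into
        240.\<close>
      also have "\<dots> \<le> (\<Sum>i=1..n. 2 * log 2 (real (card (\<Omega> i))))"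
      proof (rule sum_mono)
        fix i assume i: "i \<in> {1..n}"
        show "real (d i) \<le> 2 * log 2 (real (card (\<Omega> i)))"
        proof (cases "2 \<le> card (\<Omega> i)")
          case True
          then have "log 2 2 \<le> log 2 (real (card (\<Omega> i)))" by (subst log_le_cancel_iff) auto
          then have "1 \<le> log 2 (real (card (\<Omega> i)))" by simp
          then show ?thesis unfolding d_def by linarith
        next
          case False
          then have "card (\<Omega> i) = 0 \<or> card (\<Omega> i) = 1" by linarith
          then show ?thesis unfolding d_def by (auto simp: log_def)
        qed
      qed
      finally have "Y \<le> 120 * (\<Sum>i=1..n. 2 * log 2 (real (card (\<Omega> i)))) / \<epsilon>\<^sup>2"
        unfolding Y_def by (intro divide_right_mono mult_left_mono) auto
      then have YX: "Y \<le> 240 * X" unfolding X_def by (simp add: sum_distrib_left[symmetric])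
      have "1 \<le> card steps" using ne finite_steps by (simp add: Suc_le_eq card_gt_0_iff)
      moreover have "\<epsilon>\<^sup>2 \<le> 1" using \<epsilon> by (simp add: power_le_one)
      ultimately have Y1: "1 \<le> Y" unfolding Y_def using \<epsilon> by (simp add: field_simps)
      have pow: "120 * card steps / \<epsilon>\<^sup>2 \<le> 2 ^ J"
        using dyadic_parameter_bounds(1)[OF Y1 YX] unfolding J_def Y_def .
      have "?good (tester J) (1224 * (J + 1) ^ 3 * 2 ^ J)"
      proof (intro conjI allI impI)
        show "queries_at_most (1224 * (J + 1) ^ 3 * 2 ^ J) (tester J)" by (rule queries_at_most_tester)
        show "real (1224 * (J + 1) ^ 3 * 2 ^ J) \<le> 1224 * 11 ^ 3 * 480 * X * log 2 (2 + X) ^ 3"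
          unfolding J_def by (rule dyadic_parameter_bounds(2)[OF Y1 YX])
        show "all_queries (subcube_query n \<Omega>) (tester J)"
          by (intro all_queries_tester subcube_queries_trial ne)
        show "all_queries (prefix_query n \<Omega>) (tester J)" if "\<forall>i\<in>{1..n}. card (\<Omega> i) = 2"
          using that by (intro all_queries_tester prefix_queries_trial ne) (simp add: d_def)
        fix \<mu> assume \<mu>: "distribution_over n \<Omega> \<mu>"
        show "2 / 3 \<le> pmf (run (subcube_oracle n \<mu>) (tester J)) True" if "product_distribution n \<Omega> \<mu>"
          by (rule tester_accepts_product[OF supp[OF \<mu>] ne that])
        show "2 / 3 \<le> pmf (run (subcube_oracle n \<mu>) (tester J)) False" if "far_from_product n \<Omega> \<epsilon> \<mu>"
          by (rule tester_rejects[OF supp[OF \<mu>] ne far[OF \<mu> that] \<epsilon>(1) pow])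
      qed
      then show ?thesis by blast
    qed
  qed
  then show "\<exists>(T :: 'a subcube_alg) (q::nat). queries_at_most q T \<and>
        (let X = (\<Sum>i=1..n. log 2 (real (card (\<Omega> i)))) / \<epsilon>\<^sup>2
         in real q \<le> (1224 * 11 ^ 3 * 480) * X * (log 2 (2 + X)) ^ 3) \<and>
        all_queries (subcube_query n \<Omega>) T \<and>
        ((\<forall>i\<in>{1..n}. card (\<Omega> i) = 2) \<longrightarrow> all_queries (prefix_query n \<Omega>) T) \<and>
        (\<forall>\<mu>. distribution_over n \<Omega> \<mu> \<longrightarrow>
           (product_distribution n \<Omega> \<mu> \<longrightarrow> pmf (run (subcube_oracle n \<mu>) T) True \<ge> 2 / 3) \<and>
           (far_from_product n \<Omega> \<epsilon> \<mu> \<longrightarrow> pmf (run (subcube_oracle n \<mu>) T) False \<ge> 2 / 3))"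
    unfolding Let_def X_def .
qed

end
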